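(* Let $\rho_{AB}$ be a state on $A\otimes B$ with $\dim A=2$ and $B$ finite-dimensional. Then $$\min_{\{|a_0\rangle,|a_1\rangle\}}\big\|\rho_{AB}-\Pi_{\{|a_k\rangle\}}[\rho_{AB}]\big\|_1=\min_{\sigma\in\mathcal{CQ}}\|\rho_{AB}-\sigma\|_1,$$ where the left minimum is over orthonormal bases of $A$, $\Pi_{\{|a_k\rangle\}}[X]=\sum_k(|a_k\rangle\langle a_k|\otimes\mathbb I_B)X(|a_k\rangle\langle a_k|\otimes\mathbb I_B)$, and $\mathcal{CQ}$ is the set of classical-quantum states.
   Context: $\|\cdot\|_1$ is the trace norm. A state $\sigma_{AB}$ is classical-quantum (classical on $A$) if it can be written as $\sigma_{AB}=\sum_j|a_j\rangle\langle a_j|\otimes\sigma_j$ for some orthonormal basis $\{|a_j\rangle\}$ of $A$ and positive semidefinite operators $\sigma_j$ on $B$ (with $\sum_j\operatorname{Tr}\sigma_j=1$). *)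

theory Defs
  imports "Jordan_Normal_Form.Matrix" Complex_Main
begin

definition mtrace :: "complex mat \<Rightarrow> complex" where
  "mtrace A = (\<Sum>i<dim_row A. A $$ (i,i))"

definition adj :: "complex mat \<Rightarrow> complex mat" where
  "adj A = mat (dim_col A) (dim_row A) (\<lambda>(i,j). cnj (A $$ (j,i)))"

definition psd :: "nat \<Rightarrow> complex mat \<Rightarrow> bool" where
  "psd n A \<longleftrightarrow> A \<in> carrier_mat n n \<and> adj A = A \<and>
     (\<forall>v \<in> carrier_vec n. 0 \<le> Re (\<Sum>i<n. cnj (v $ i) * (A *\<^sub>v v) $ i))"

definition density_state :: "nat \<Rightarrow> complex mat \<Rightarrow> bool" where
  "density_state n A \<longleftrightarrow> psd n A \<and> mtrace A = 1"

definition trace_norm :: "complex mat \<Rightarrow> real" where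
  "trace_norm X = Re (mtrace (THE P. psd (dim_col X) P \<and> P * P = adj X * X))"

definition kron :: "complex mat \<Rightarrow> complex mat \<Rightarrow> complex mat" where
  "kron A B = mat (dim_row A * dim_row B) (dim_col A * dim_col B)
     (\<lambda>(i,j). A $$ (i div dim_row B, j div dim_col B) * B $$ (i mod dim_row B, j mod dim_col B))"

definition inner2 :: "complex vec \<Rightarrow> complex vec \<Rightarrow> complex" where
  "inner2 u v = (\<Sum>i<2. cnj (u $ i) * v $ i)"

definition onb2 :: "complex vec \<Rightarrow> complex vec \<Rightarrow> bool" where
  "onb2 a0 a1 \<longleftrightarrow> a0 \<in> carrier_vec 2 \<and> a1 \<in> carrier_vec 2 \<and>
     inner2 a0 a0 = 1 \<and> inner2 a1 a1 = 1 \<and> inner2 a0 a1 = 0"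

definition ketbra :: "complex vec \<Rightarrow> complex mat" where
  "ketbra a = mat (dim_vec a) (dim_vec a) (\<lambda>(i,j). a $ i * cnj (a $ j))"

definition dephase :: "nat \<Rightarrow> complex vec \<Rightarrow> complex vec \<Rightarrow> complex mat \<Rightarrow> complex mat" where
  "dephase d a0 a1 X =
     kron (ketbra a0) (1\<^sub>m d) * X * kron (ketbra a0) (1\<^sub>m d)
   + kron (ketbra a1) (1\<^sub>m d) * X * kron (ketbra a1) (1\<^sub>m d)"

definition cq_state :: "nat \<Rightarrow> complex mat \<Rightarrow> bool" where
  "cq_state d \<sigma> \<longleftrightarrow> (\<exists>a0 a1 s0 s1. onb2 a0 a1 \<and> psd d s0 \<and> psd d s1 \<and>
     mtrace s0 + mtrace s1 = 1 \<and> \<sigma> = kron (ketbra a0) s0 + kron (ketbra a1) s1)"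

end

theory Submission
  imports "HOL-Analysis.Topology_Euclidean_Space"
    "HOL-Computational_Algebra.Fundamental_Theorem_Algebra"
    "Jordan_Normal_Form.Schur_Decomposition" Defs
begin

text \<open>
  For a basis \<open>a\<close> of the qubit let \<open>Z\<close> be the reflection \<open>(|a\<^sub>0><a\<^sub>0| - |a\<^sub>1><a\<^sub>1|) \<otimes> 1\<close>. Dephasing is
  the average of \<open>M\<close> and \<open>Z M Z\<close>, so \<open>M - \<Pi>[M] = (M - Z M Z) / 2\<close> and the triangle inequality gives
  \<open>\<parallel>M - \<Pi>[M]\<parallel> \<le> \<parallel>M\<parallel>\<close>. This is special to dimension two. A state \<open>\<sigma>\<close> that is classical
  in the basis \<open>a\<close> is fixed by \<open>\<Pi>\<close>, so \<open>M = \<rho> - \<sigma>\<close> yields \<open>\<parallel>\<rho> - \<Pi>[\<rho>]\<parallel> \<le> \<parallel>\<rho> - \<sigma>\<parallel>\<close>, while \<open>\<Pi>[\<rho>]\<close> is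
  itself classical-quantum. The minimum over bases exists by compactness.

  All properties of the trace norm of a Hermitian matrix \<open>X\<close> come from one characterization:
  it is the least trace of a matrix \<open>Q\<close> with \<open>-Q \<le> X \<le> Q\<close>.
\<close>

hide_type (open) Finite_Cartesian_Product.vec
unbundle no vec_syntax
unbundle no inner_syntax

section \<open>Adjoints, traces and positive semidefinite matrices\<close>

lemma sum_lessThan_single:
  fixes f :: "nat \<Rightarrow> 'a::comm_monoid_add"
  assumes "j < n" "\<And>i. i < n \<Longrightarrow> i \<noteq> j \<Longrightarrow> f i = 0"
  shows "(\<Sum>i<n. f i) = f j"
  using assms by (subst sum.remove[of _ j]) auto

lemma mult_mat_entry:
  assumes "A \<in> carrier_mat n m" "B \<in> carrier_mat m k" "i < n" "j < k"
  shows "(A * B) $$ (i,j) = (\<Sum>l<m. A $$ (i,l) * B $$ (l,j))"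
  using assms by (auto simp: scalar_prod_def lessThan_atLeast0)

lemma mult_mat_vec_entry:
  assumes "A \<in> carrier_mat n m" "v \<in> carrier_vec m" "i < n"
  shows "(A *\<^sub>v v) $ i = (\<Sum>l<m. A $$ (i,l) * v $ l)"
  using assms by (auto simp: scalar_prod_def lessThan_atLeast0)

lemma adj_carrier [simp, intro]: "A \<in> carrier_mat n m \<Longrightarrow> adj A \<in> carrier_mat m n"
  by (auto simp: adj_def)

lemma adj_index [simp]: "i < dim_col A \<Longrightarrow> j < dim_row A \<Longrightarrow> adj A $$ (i,j) = cnj (A $$ (j,i))"
  by (auto simp: adj_def)

lemma adj_dim [simp]: "dim_row (adj A) = dim_col A" "dim_col (adj A) = dim_row A"
  by (auto simp: adj_def)

lemma adj_adj [simp]: "adj (adj A) = A"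
  by (auto simp: adj_def)

lemma adj_one [simp]: "adj (1\<^sub>m n) = 1\<^sub>m n"
  by (auto simp: adj_def)

lemma adj_mult:
  assumes "A \<in> carrier_mat n m" "B \<in> carrier_mat m k"
  shows "adj (A * B) = adj B * adj A"
  using assms by (intro eq_matI) (auto simp: scalar_prod_def mult.commute)

lemma adj_add:
  assumes "A \<in> carrier_mat n m" "B \<in> carrier_mat n m"
  shows "adj (A + B) = adj A + adj B"
  using assms by (intro eq_matI) auto

lemma adj_minus:
  assumes "A \<in> carrier_mat n m" "B \<in> carrier_mat n m"
  shows "adj (A - B) = adj A - adj B"
  using assms by (intro eq_matI) auto

lemma adj_smult: "adj (c \<cdot>\<^sub>m A) = cnj c \<cdot>\<^sub>m adj A"
  by (intro eq_matI) auto

lemma mtrace_add: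
  assumes "A \<in> carrier_mat n n" "B \<in> carrier_mat n n"
  shows "mtrace (A + B) = mtrace A + mtrace B"
  using assms by (auto simp: mtrace_def sum.distrib)

lemma mtrace_smult:
  assumes "A \<in> carrier_mat n n"
  shows "mtrace (c \<cdot>\<^sub>m A) = c * mtrace A"
  using assms by (auto simp: mtrace_def sum_distrib_left)

lemma mtrace_mult_commute:
  assumes "A \<in> carrier_mat n m" "B \<in> carrier_mat m n"
  shows "mtrace (A * B) = mtrace (B * A)"
proof -
  have "mtrace (A * B) = (\<Sum>i<n. \<Sum>l<m. A $$ (i,l) * B $$ (l,i))"
    using assms by (auto simp: mtrace_def mult_mat_entry simp del: index_mult_mat(1))
  also have "\<dots> = (\<Sum>l<m. \<Sum>i<n. B $$ (l,i) * A $$ (i,l))"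
    by (subst sum.swap) (simp add: mult.commute)
  also have "\<dots> = mtrace (B * A)"
    using assms by (auto simp: mtrace_def mult_mat_entry simp del: index_mult_mat(1))
  finally show ?thesis .
qed

section \<open>The complex inner product and positive semidefinite forms\<close>

definition cinner :: "complex vec \<Rightarrow> complex vec \<Rightarrow> complex" where
  "cinner u v = (\<Sum>i<dim_vec v. cnj (u $ i) * v $ i)"

lemma cinner_add_right:
  assumes "v \<in> carrier_vec n" "w \<in> carrier_vec n"
  shows "cinner u (v + w) = cinner u v + cinner u w"
  using assms by (auto simp: cinner_def algebra_simps sum.distrib)

lemma cinner_smult_right: "cinner u (c \<cdot>\<^sub>v v) = c * cinner u v"
  by (auto simp: cinner_def sum_distrib_left algebra_simps)

lemma cinner_self: "cinner v v = complex_of_real (\<Sum>i<dim_vec v. (cmod (v $ i))\<^sup>2)"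
  by (auto simp: cinner_def complex_norm_square mult.commute simp flip: of_real_power)

lemma cinner_self_eq_0:
  assumes "v \<in> carrier_vec n" "Re (cinner v v) \<le> 0"
  shows "v = 0\<^sub>v n"
proof -
  have "(\<Sum>i<n. (cmod (v $ i))\<^sup>2) = 0"
    using assms by (intro antisym sum_nonneg) (auto simp: cinner_self)
  hence "\<forall>i<n. v $ i = 0"
    by (subst (asm) sum_nonneg_eq_0_iff) auto
  thus ?thesis using assms by (intro eq_vecI) auto
qed

lemma cinner_mult_mat_vec:
  assumes "A \<in> carrier_mat n m" "u \<in> carrier_vec n" "v \<in> carrier_vec m"
  shows "cinner u (A *\<^sub>v v) = cinner (adj A *\<^sub>v u) v"
proof -
  have "cinner u (A *\<^sub>v v) = (\<Sum>i<n. \<Sum>l<m. cnj (u $ i) * A $$ (i,l) * v $ l)"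
    using assms by (auto simp: cinner_def mult_mat_vec_entry sum_distrib_left mult.assoc
        simp del: index_mult_mat_vec)
  also have "\<dots> = (\<Sum>l<m. \<Sum>i<n. cnj (u $ i) * A $$ (i,l) * v $ l)"
    by (rule sum.swap)
  also have "\<dots> = cinner (adj A *\<^sub>v u) v"
    using assms by (auto simp: cinner_def mult_mat_vec_entry[OF adj_carrier] sum_distrib_left
        sum_distrib_right mult_ac simp del: index_mult_mat_vec intro!: sum.cong)
  finally show ?thesis .
qed

lemma psd_iff:
  "psd n A \<longleftrightarrow> A \<in> carrier_mat n n \<and> adj A = A \<and>
     (\<forall>v \<in> carrier_vec n. 0 \<le> Re (cinner v (A *\<^sub>v v)))"
  unfolding psd_def cinner_def by auto

lemma psd_carrier: "psd n A \<Longrightarrow> A \<in> carrier_mat n n"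
  by (simp add: psd_def)

text \<open>Moving \<open>adj C\<close> across the inner product turns the quadratic form at
  \<open>v\<close> into that of \<open>A\<close> at \<open>C *\<^sub>v v\<close>. \<open>C\<close>
  may be rectangular, which is needed later to compress a bipartite state to an operator on
  B.\<close>

lemma psd_congruence:
  assumes "psd n A" "C \<in> carrier_mat n m"
  shows "psd m (adj C * A * C)"
proof -
  have A: "A \<in> carrier_mat n n" "adj A = A" using assms by (auto simp: psd_def)
  note C = assms(2)
  have "adj (adj C * A * C) = adj C * A * C"
    using A C by (simp add: adj_mult[of "adj C" m n "A * C" m] adj_mult[of A n n C m]
        assoc_mult_mat[of _ m n _ n _ m])
  moreover have "0 \<le> Re (cinner v ((adj C * A * C) *\<^sub>v v))" if "v \<in> carrier_vec m" for v
  proof -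
    have w: "C *\<^sub>v v \<in> carrier_vec n" using C that by auto
    have "(adj C * A * C) *\<^sub>v v = adj C *\<^sub>v (A *\<^sub>v (C *\<^sub>v v))"
      using mult_carrier_mat[of "adj C" m n A n]
        assoc_mult_mat_vec[of "adj C * A" m n C m v]
        assoc_mult_mat_vec[of "adj C" m n A n "C *\<^sub>v v"]
        A C that by auto
    also have "cinner v \<dots> = cinner (C *\<^sub>v v) (A *\<^sub>v (C *\<^sub>v v))"
      using cinner_mult_mat_vec[of "adj C" m n v "A *\<^sub>v (C *\<^sub>v v)"] A C that by auto
    finally show ?thesis using assms(1) w by (auto simp: psd_iff)
  qed
  ultimately show ?thesis using A C by (auto simp: psd_iff)
qed

lemma psd_add:
  assumes "psd n A" "psd n B"
  shows "psd n (A + B)"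
  using assms by (auto simp: psd_iff adj_add[of _ n n] add_mult_distrib_mat_vec[of _ n n]
      cinner_add_right[of _ n])

lemma psd_smult:
  assumes "psd n A" "0 \<le> (c::real)"
  shows "psd n (complex_of_real c \<cdot>\<^sub>m A)"
proof -
  have "cinner v ((complex_of_real c \<cdot>\<^sub>m A) *\<^sub>v v) = complex_of_real c * cinner v (A *\<^sub>v v)"
    if "v \<in> carrier_vec n" for v
  proof -
    have "(complex_of_real c \<cdot>\<^sub>m A) *\<^sub>v v = complex_of_real c \<cdot>\<^sub>v (A *\<^sub>v v)"
      using assms that by (intro eq_vecI) (auto simp: psd_def)
    thus ?thesis by (simp add: cinner_smult_right)
  qed
  thus ?thesis using assms by (auto simp: psd_iff adj_smult)
qed

text \<open>The diagonal entry is the quadratic form at a unit vector. This is all that the lower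
  bound in \<open>trace_norm_le\<close> takes from positivity.\<close>

lemma psd_diag_entry:
  assumes "psd n A" "i < n"
  shows "0 \<le> Re (A $$ (i,i))"
proof -
  have A: "A \<in> carrier_mat n n" using assms by (simp add: psd_def)
  have "cinner (unit_vec n i) (A *\<^sub>v unit_vec n i) = A $$ (i,i)"
    using A assms(2) unfolding cinner_def by (subst sum_lessThan_single[of i]) auto
  moreover have "0 \<le> Re (cinner (unit_vec n i) (A *\<^sub>v unit_vec n i))"
    using assms by (auto simp: psd_iff)
  ultimately show ?thesis by simp
qed

section \<open>Diagonal matrices with real entries\<close>

definition diagm :: "nat \<Rightarrow> (nat \<Rightarrow> real) \<Rightarrow> complex mat" where
  "diagm n \<mu> = mat n n (\<lambda>(i,j). if i = j then complex_of_real (\<mu> i) else 0)"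

lemma diagm_carrier [simp, intro]: "diagm n \<mu> \<in> carrier_mat n n"
  by (simp add: diagm_def)

lemma diagm_index [simp]:
  "i < n \<Longrightarrow> j < n \<Longrightarrow> diagm n \<mu> $$ (i,j) = (if i = j then complex_of_real (\<mu> i) else 0)"
  by (simp add: diagm_def)

lemma diagm_dim [simp]: "dim_row (diagm n \<mu>) = n" "dim_col (diagm n \<mu>) = n"
  by (simp_all add: diagm_def)

lemma adj_diagm [simp]: "adj (diagm n \<mu>) = diagm n \<mu>"
  by (intro eq_matI) auto

lemma diagm_add: "diagm n \<mu> + diagm n \<nu> = diagm n (\<lambda>i. \<mu> i + \<nu> i)"
  by (intro eq_matI) auto

lemma diagm_minus: "diagm n \<mu> - diagm n \<nu> = diagm n (\<lambda>i. \<mu> i - \<nu> i)"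
  by (intro eq_matI) auto

lemma diagm_mult: "diagm n \<mu> * diagm n \<nu> = diagm n (\<lambda>i. \<mu> i * \<nu> i)"
proof (intro eq_matI)
  fix i j assume "i < dim_row (diagm n (\<lambda>i. \<mu> i * \<nu> i))" "j < dim_col (diagm n (\<lambda>i. \<mu> i * \<nu> i))"
  hence ij: "i < n" "j < n" by auto
  thus "(diagm n \<mu> * diagm n \<nu>) $$ (i,j) = diagm n (\<lambda>i. \<mu> i * \<nu> i) $$ (i,j)"
    by (subst mult_mat_entry[of _ n n _ n]; (simp; fail)?) (subst sum_lessThan_single[of i]; simp)
qed auto

lemma mtrace_diagm: "mtrace (diagm n \<mu>) = complex_of_real (\<Sum>i<n. \<mu> i)"
  by (simp add: mtrace_def)

lemma diagm_mult_vec: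
  assumes "v \<in> carrier_vec n"
  shows "diagm n \<mu> *\<^sub>v v = vec n (\<lambda>i. complex_of_real (\<mu> i) * v $ i)"
proof (intro eq_vecI)
  fix i assume "i < dim_vec (vec n (\<lambda>i. complex_of_real (\<mu> i) * v $ i))"
  hence i: "i < n" by simp
  thus "(diagm n \<mu> *\<^sub>v v) $ i = vec n (\<lambda>i. complex_of_real (\<mu> i) * v $ i) $ i"
    using assms by (subst mult_mat_vec_entry[of _ n n]; (simp; fail)?) (subst sum_lessThan_single[of i]; simp)
qed auto

lemma psd_diagm:
  assumes "\<And>i. i < n \<Longrightarrow> 0 \<le> \<mu> i"
  shows "psd n (diagm n \<mu>)"
proof -
  have "0 \<le> Re (cinner v (diagm n \<mu> *\<^sub>v v))" if "v \<in> carrier_vec n" for v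
  proof -
    have "cinner v (diagm n \<mu> *\<^sub>v v) = (\<Sum>i<n. complex_of_real (\<mu> i * (cmod (v $ i))\<^sup>2))"
      using that unfolding diagm_mult_vec[OF that] cinner_def
      by (auto intro!: sum.cong simp: complex_norm_square mult.commute simp flip: of_real_power)
    also have "Re \<dots> \<ge> 0" using assms by (auto intro!: sum_nonneg)
    finally show ?thesis .
  qed
  thus ?thesis by (auto simp: psd_iff)
qed

lemma unitary_adj:
  assumes "U \<in> carrier_mat n n" "adj U * U = 1\<^sub>m n"
  shows "U * adj U = 1\<^sub>m n"
  using mat_mult_left_right_inverse[of "adj U" n U] assms by auto

section \<open>Unitary diagonalization of Hermitian matrices\<close>

text \<open>Complete \<open>v\<close> to a basis, apply Gram-Schmidt with \<open>v\<close> first,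
  and normalize the result. The factor \<open>c\<close> is the reciprocal of the norm of
  \<open>v\<close>.\<close>

lemma exists_unitary_first_col:
  assumes v: "v \<in> carrier_vec n" "v \<noteq> 0\<^sub>v n"
  shows "\<exists>U c. U \<in> carrier_mat n n \<and> adj U * U = 1\<^sub>m n \<and> col U 0 = c \<cdot>\<^sub>v v"
proof -
  interpret cof_vec_space n "TYPE(complex)" .
  define b where "b = basis_completion v"
  define ws where "ws = gram_schmidt n b"
  from basis_completion[OF v, folded b_def]
  have dist_b: "distinct b" and indep: "\<not> lin_dep (set b)" and b: "set b \<subseteq> carrier_vec n"
    and hdb: "hd b = v" and len_b: "length b = n"
    by auto
  have n: "n > 0" using v by (cases n) auto
  with hdb len_b obtain vs where bv: "b = v # vs" by (cases b) auto
  from gram_schmidt_result[OF b dist_b indep refl, folded ws_def]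
  have ws: "set ws \<subseteq> carrier_vec n" "corthogonal ws" "length ws = n"
    by (auto simp: len_b)
  have "hd ws = v" using gram_schmidt_hd[OF v(1), of vs, folded bv] unfolding ws_def .
  hence ws0: "ws ! 0 = v" using n ws by (metis hd_conv_nth length_greater_0_conv)
  have wsc: "ws ! i \<in> carrier_vec n" if "i < n" for i using ws that by auto
  have orth: "(\<Sum>k<n. cnj (ws ! i $ k) * ws ! j $ k) = 0 \<longleftrightarrow> i \<noteq> j" if "i < n" "j < n" for i j
  proof -
    have "ws ! j \<bullet>c ws ! i = (\<Sum>k<n. cnj (ws ! i $ k) * ws ! j $ k)"
      using wsc[OF that(1)] wsc[OF that(2)]
      by (auto simp: scalar_prod_def lessThan_atLeast0 mult.commute intro!: sum.cong)
    thus ?thesis using corthogonalD[OF ws(2), of j i] that ws(3) by auto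
  qed
  define r where "r i = sqrt (\<Sum>k<n. (cmod (ws ! i $ k))\<^sup>2)" for i
  have r2: "(\<Sum>k<n. cnj (ws ! i $ k) * ws ! i $ k) = complex_of_real (r i * r i)" for i
    by (auto simp: r_def sum_nonneg complex_norm_square mult.commute simp flip: of_real_power)
  \<comment> \<open>\<open>corthogonal\<close> includes that no vector is orthogonal to itself, so
    the norms can be divided out.\<close>
  have r0: "r i \<noteq> 0" if "i < n" for i
    using orth[OF that that] r2[of i] by auto
  define U where "U = mat n n (\<lambda>(k,i). ws ! i $ k / complex_of_real (r i))"
  have U: "U \<in> carrier_mat n n" by (simp add: U_def)
  have "(adj U * U) $$ (i,j) = 1\<^sub>m n $$ (i,j)" if "i < n" "j < n" for i j
  proof -
    have "(adj U * U) $$ (i,j) = (\<Sum>k<n. cnj (U $$ (k,i)) * U $$ (k,j))"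
      using that U by (subst mult_mat_entry[of _ n n _ n]) auto
    also have "\<dots> = (\<Sum>k<n. cnj (ws ! i $ k) * ws ! j $ k) / (complex_of_real (r i) * complex_of_real (r j))"
      using that by (auto simp: U_def sum_divide_distrib)
    also have "\<dots> = 1\<^sub>m n $$ (i,j)"
      using orth[OF that] r2[of i] r0 that by auto
    finally show ?thesis .
  qed
  hence "adj U * U = 1\<^sub>m n" using U by (intro eq_matI) auto
  moreover have "col U 0 = (1 / complex_of_real (r 0)) \<cdot>\<^sub>v v"
    using n v by (intro eq_vecI) (auto simp: U_def ws0)
  ultimately show ?thesis using U by blast
qed

text \<open>The characteristic polynomial has degree \<open>n > 0\<close>, hence a complex
  root.\<close>

lemma complex_mat_eigenvector_exists:
  assumes "A \<in> carrier_mat n n" "n > 0"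
  shows "\<exists>v e. v \<in> carrier_vec n \<and> v \<noteq> 0\<^sub>v n \<and> A *\<^sub>v v = (e::complex) \<cdot>\<^sub>v v"
proof -
  have "\<not> constant (poly (char_poly A))"
    using degree_monic_char_poly[OF assms(1)] assms(2) by (simp add: constant_degree)
  then obtain e where "poly (char_poly A) e = 0"
    using fundamental_theorem_of_algebra by blast
  hence "eigenvalue A e" using eigenvalue_root_char_poly[OF assms(1)] by simp
  thus ?thesis using assms(1) unfolding eigenvalue_def eigenvector_def by auto
qed

lemma adj_four_block_mat:
  assumes "A \<in> carrier_mat n1 n1" "B \<in> carrier_mat n1 n2" "C \<in> carrier_mat n2 n1" "D \<in> carrier_mat n2 n2"
  shows "adj (four_block_mat A B C D) = four_block_mat (adj A) (adj C) (adj B) (adj D)"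
  using assms by (intro eq_matI) auto

text \<open>Induction on the dimension. A unitary \<open>W\<close> whose first column is an
  eigenvector makes the first column of \<open>Y\<close> a multiple of the first unit vector; since
  \<open>Y\<close> is Hermitian, its first row vanishes off the diagonal too, and a smaller
  Hermitian block \<open>X'\<close> remains.\<close>

theorem hermitian_diagonalization:
  assumes "X \<in> carrier_mat n n" "adj X = X"
  shows "\<exists>U \<mu>. U \<in> carrier_mat n n \<and> adj U * U = 1\<^sub>m n \<and> X = U * diagm n \<mu> * adj U"
  using assms
proof (induction n arbitrary: X)
  case 0
  thus ?case by (intro exI[of _ "1\<^sub>m 0"] exI[of _ "\<lambda>_. 0"]) auto
next
  case (Suc n)
  let ?n = "Suc n"
  note X = Suc.prems
  obtain v e where v: "v \<in> carrier_vec ?n" "v \<noteq> 0\<^sub>v ?n" and Xv: "X *\<^sub>v v = e \<cdot>\<^sub>v v"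
    using complex_mat_eigenvector_exists[OF X(1)] by auto
  obtain W c where W: "W \<in> carrier_mat ?n ?n" and WW: "adj W * W = 1\<^sub>m ?n" and W0: "col W 0 = c \<cdot>\<^sub>v v"
    using exists_unitary_first_col[OF v] by auto
  have WW': "W * adj W = 1\<^sub>m ?n" using unitary_adj[OF W WW] .
  define Y where "Y = adj W * X * W"
  have Y: "Y \<in> carrier_mat ?n ?n" using W X by (auto simp: Y_def)
  have adjY: "adj Y = Y"
    using W X unfolding Y_def
    by (simp add: adj_mult[of "adj W" ?n ?n "X * W" ?n] adj_mult[of X ?n ?n W ?n]
        assoc_mult_mat[of _ ?n ?n _ ?n _ ?n] mult_carrier_mat[of _ ?n ?n _ ?n])
  have XY: "X = W * Y * adj W"
  proof -
    have "W * Y * adj W = (W * adj W) * X * (W * adj W)"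
      unfolding Y_def using W X by (simp add: assoc_mult_mat[of _ ?n ?n _ ?n _ ?n] mult_carrier_mat[of _ ?n ?n _ ?n])
    thus ?thesis using WW' X by simp
  qed
  have "col Y 0 = adj W *\<^sub>v (X *\<^sub>v col W 0)"
    using col_mult2[of "adj W" ?n ?n "X * W" ?n 0] col_mult2[of X ?n ?n W ?n 0] W X
      mult_carrier_mat[of X ?n ?n W ?n] assoc_mult_mat[of "adj W" ?n ?n X ?n W ?n]
    unfolding Y_def by simp
  also have "X *\<^sub>v col W 0 = e \<cdot>\<^sub>v col W 0"
    using X v Xv unfolding W0 by (simp add: mult_mat_vec[of _ ?n ?n] smult_smult_assoc mult.commute)
  also have "adj W *\<^sub>v (e \<cdot>\<^sub>v col W 0) = e \<cdot>\<^sub>v (adj W *\<^sub>v col W 0)"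
    using W col_dim[of W 0] by (intro mult_mat_vec[of _ ?n ?n]) auto
  also have "adj W *\<^sub>v col W 0 = col (adj W * W) 0"
    using W by (simp add: col_mult2[of _ ?n ?n _ ?n])
  finally have col0: "col Y 0 = e \<cdot>\<^sub>v unit_vec ?n 0" unfolding WW by simp
  have Yi0: "Y $$ (i,0) = (if i = 0 then e else 0)" if "i < ?n" for i
    using arg_cong[OF col0, of "\<lambda>v. v $ i"] that Y by (auto split: if_splits)
  have Yswap: "Y $$ (i,j) = cnj (Y $$ (j,i))" if "i < ?n" "j < ?n" for i j
    using arg_cong[OF adjY, of "\<lambda>A. A $$ (i,j)"] that Y by auto
  \<comment> \<open>A diagonal entry of a Hermitian matrix is real, so the new eigenvalue fits into
    \<open>diagm\<close>.\<close>
  have e: "e = complex_of_real (Re e)"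
    using Yswap[of 0 0] Yi0[of 0] by (simp add: complex_eq_iff)
  define X' where "X' = mat n n (\<lambda>(i,j). Y $$ (Suc i, Suc j))"
  have X': "X' \<in> carrier_mat n n" by (simp add: X'_def)
  have "adj X' = X'"
    by (intro eq_matI) (auto simp: X'_def Yswap[symmetric])
  then obtain U \<mu> where U: "U \<in> carrier_mat n n" and UU: "adj U * U = 1\<^sub>m n"
    and X'U: "X' = U * diagm n \<mu> * adj U"
    using Suc.IH[OF X'] by blast
  \<comment> \<open>The new eigenvalue takes index 0 and those of the block \<open>X'\<close> move
    up by one.\<close>
  define \<nu> where "\<nu> i = (case i of 0 \<Rightarrow> Re e | Suc i \<Rightarrow> \<mu> i)" for i
  let ?blk = "\<lambda>(a::complex) D. four_block_mat (a \<cdot>\<^sub>m 1\<^sub>m 1) (0\<^sub>m 1 n) (0\<^sub>m n 1) D"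
  have blk_mult: "?blk a A * ?blk b B = ?blk (a * b) (A * B)"
    if "A \<in> carrier_mat n n" "B \<in> carrier_mat n n" for a b :: complex and A B
    using that by (subst mult_four_block_mat[of _ 1 1 _ n _ n]) (auto intro!: eq_matI)
  have blk_adj: "adj (?blk 1 U) = ?blk 1 (adj U)"
    using U by (subst adj_four_block_mat[of _ 1 _ n]) (auto intro!: eq_matI)
  have Yblk: "Y = ?blk e X'"
  proof (intro eq_matI)
    fix i j assume "i < dim_row (?blk e X')" "j < dim_col (?blk e X')"
    hence ij: "i < ?n" "j < ?n" using X' by auto
    show "Y $$ (i,j) = ?blk e X' $$ (i,j)"
      using ij Yi0[of i] Yi0[of j] Yswap[of i j] X'
      by (cases i; cases j) (auto simp: X'_def)
  qed (use X' Y in auto)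
  have dblk: "diagm ?n \<nu> = ?blk e (diagm n \<mu>)"
  proof (intro eq_matI)
    fix i j assume "i < dim_row (?blk e (diagm n \<mu>))" "j < dim_col (?blk e (diagm n \<mu>))"
    thus "diagm ?n \<nu> $$ (i,j) = ?blk e (diagm n \<mu>) $$ (i,j)"
      using e by (cases i; cases j) (auto simp: \<nu>_def)
  qed auto
  have one_blk: "?blk 1 (1\<^sub>m n) = 1\<^sub>m ?n"
    by (intro eq_matI) auto
  let ?V = "?blk 1 U"
  have V: "?V \<in> carrier_mat ?n ?n" using U by auto
  have VV: "adj ?V * ?V = 1\<^sub>m ?n"
    unfolding blk_adj using blk_mult[of "adj U" U 1 1] U UU one_blk by simp
  have YV: "Y = ?V * diagm ?n \<nu> * adj ?V"
    unfolding blk_adj dblk Yblk X'U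
    using blk_mult[of U "diagm n \<mu>" 1 e] blk_mult[of "U * diagm n \<mu>" "adj U" "1 * e" 1] U by simp
  have WV: "W * ?V \<in> carrier_mat ?n ?n" using W V by auto
  have adjWV: "adj (W * ?V) = adj ?V * adj W" using adj_mult[OF W V] .
  have "adj (W * ?V) * (W * ?V) = adj ?V * (adj W * W) * ?V"
    unfolding adjWV using W V adj_carrier[OF V]
    by (simp only: assoc_mult_mat[of _ ?n ?n _ ?n _ ?n] mult_carrier_mat[of _ ?n ?n _ ?n]
      adj_carrier)
  hence 1: "adj (W * ?V) * (W * ?V) = 1\<^sub>m ?n"
    unfolding WW right_mult_one_mat[OF adj_carrier[OF V]] VV .
  have 2: "X = (W * ?V) * diagm ?n \<nu> * adj (W * ?V)"
    unfolding adjWV unfolding XY unfolding YV using W V adj_carrier[OF V]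
    by (simp only: assoc_mult_mat[of _ ?n ?n _ ?n _ ?n] mult_carrier_mat[of _ ?n ?n _ ?n] adj_carrier diagm_carrier)
  from WV 1 2 show ?case by blast
qed

section \<open>The trace norm of Hermitian matrices\<close>

text \<open>Uniqueness of the positive square root, one eigenvector at a time: (R + c)(R - c) v = 0,
  and R + c is injective for c > 0.\<close>

lemma psd_sqrt_eigenvector:
  assumes R: "psd n R" and v: "v \<in> carrier_vec n" and c: "0 \<le> (c::real)"
    and RR: "R *\<^sub>v (R *\<^sub>v v) = complex_of_real (c * c) \<cdot>\<^sub>v v"
  shows "R *\<^sub>v v = complex_of_real c \<cdot>\<^sub>v v"
proof -
  have Rc: "R \<in> carrier_mat n n" and Ra: "adj R = R" using R by (auto simp: psd_def)
  have Rv: "R *\<^sub>v v \<in> carrier_vec n" using Rc v by auto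
  show ?thesis
  proof (cases "c = 0")
    case True
    \<comment> \<open>For c = 0 injectivity may fail, but Hermiticity gives |R v|^2 = <v, R R v> = 0
      directly.\<close>
    have "cinner (R *\<^sub>v v) (R *\<^sub>v v) = cinner v (R *\<^sub>v (R *\<^sub>v v))"
      using cinner_mult_mat_vec[OF Rc v Rv] Ra by simp
    also have "\<dots> = 0" unfolding RR using True by (simp add: cinner_smult_right)
    finally have "R *\<^sub>v v = 0\<^sub>v n" using cinner_self_eq_0[OF Rv] by simp
    thus ?thesis using True v by auto
  next
    case False
    \<comment> \<open>The defect \<open>w\<close> satisfies \<open>R w = -c w\<close>, which positivity of \<open>R\<close> allows only for \<open>w = 0\<close>.\<close>
    let ?w = "R *\<^sub>v v - complex_of_real c \<cdot>\<^sub>v v"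
    have w: "?w \<in> carrier_vec n" using Rv v by auto
    have "R *\<^sub>v ?w = R *\<^sub>v (R *\<^sub>v v) - complex_of_real c \<cdot>\<^sub>v (R *\<^sub>v v)"
      using Rc Rv v by (simp add: mult_minus_distrib_mat_vec[of _ n n] mult_mat_vec[of _ n n])
    also have "\<dots> = complex_of_real (- c) \<cdot>\<^sub>v ?w"
      unfolding RR using v Rv Rc by (intro eq_vecI) (auto simp: algebra_simps)
    finally have "Re (cinner ?w (R *\<^sub>v ?w)) = - c * Re (cinner ?w ?w)"
      by (simp add: cinner_smult_right)
    moreover have "0 \<le> Re (cinner ?w (R *\<^sub>v ?w))" using R w by (auto simp: psd_iff)
    ultimately have "c * Re (cinner ?w ?w) \<le> 0" by simp
    hence "Re (cinner ?w ?w) \<le> 0" using c False by (simp add: mult_le_0_iff)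
    hence w0: "?w = 0\<^sub>v n" using cinner_self_eq_0[OF w] by simp
    show ?thesis
    proof (intro eq_vecI)
      fix i assume "i < dim_vec (complex_of_real c \<cdot>\<^sub>v v)"
      thus "(R *\<^sub>v v) $ i = (complex_of_real c \<cdot>\<^sub>v v) $ i"
        using arg_cong[OF w0, of "\<lambda>w. w $ i"] v Rc by auto
    qed (use Rc v in auto)
  qed
qed

text \<open>Each unit vector is an eigenvector of \<open>R * R\<close>, hence of \<open>R\<close>,
  and this determines every column of \<open>R\<close>.\<close>

lemma psd_sqrt_diagm:
  assumes R: "psd n R" and RR: "R * R = diagm n (\<lambda>i. \<mu> i * \<mu> i)"
  shows "R = diagm n (\<lambda>i. \<bar>\<mu> i\<bar>)"
proof (intro eq_matI)
  have Rc: "R \<in> carrier_mat n n" using R by (auto simp: psd_def)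
  fix i j assume "i < dim_row (diagm n (\<lambda>i. \<bar>\<mu> i\<bar>))" "j < dim_col (diagm n (\<lambda>i. \<bar>\<mu> i\<bar>))"
  hence ij: "i < n" "j < n" by auto
  let ?e = "unit_vec n j :: complex vec"
  have "R *\<^sub>v (R *\<^sub>v ?e) = diagm n (\<lambda>i. \<mu> i * \<mu> i) *\<^sub>v ?e"
    using Rc assoc_mult_mat_vec[of R n n R n ?e] RR by auto
  also have "\<dots> = complex_of_real (\<bar>\<mu> j\<bar> * \<bar>\<mu> j\<bar>) \<cdot>\<^sub>v ?e"
    using ij by (subst diagm_mult_vec) (auto intro!: eq_vecI)
  finally have "R *\<^sub>v ?e = complex_of_real \<bar>\<mu> j\<bar> \<cdot>\<^sub>v ?e"
    by (intro psd_sqrt_eigenvector[OF R]) auto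
  hence "(R *\<^sub>v ?e) $ i = (complex_of_real \<bar>\<mu> j\<bar> \<cdot>\<^sub>v ?e) $ i" by simp
  thus "R $$ (i,j) = diagm n (\<lambda>i. \<bar>\<mu> i\<bar>) $$ (i,j)"
    using ij Rc by auto
qed (use R in \<open>auto simp: psd_def\<close>)

lemma unitary_conj_cancel:
  assumes U: "U \<in> carrier_mat n n" "adj U * U = 1\<^sub>m n" and A: "A \<in> carrier_mat n n"
  shows "adj U * (U * A * adj U) * U = A" "U * (adj U * A * U) * adj U = A"
proof -
  have UU: "U * adj U = 1\<^sub>m n" using unitary_adj[OF U] .
  have "adj U * (U * A * adj U) * U = (adj U * U) * A * (adj U * U)"
    using U(1) A by (simp add: assoc_mult_mat[of _ n n _ n _ n] mult_carrier_mat[of _ n n _ n])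
  thus "adj U * (U * A * adj U) * U = A" using U A by simp
  have "U * (adj U * A * U) * adj U = (U * adj U) * A * (U * adj U)"
    using U(1) A by (simp add: assoc_mult_mat[of _ n n _ n _ n] mult_carrier_mat[of _ n n _ n])
  thus "U * (adj U * A * U) * adj U = A" using UU A by simp
qed

lemma unitary_conj_mult:
  assumes U: "U \<in> carrier_mat n n" "adj U * U = 1\<^sub>m n"
    and A: "A \<in> carrier_mat n n" and B: "B \<in> carrier_mat n n"
  shows "(U * A * adj U) * (U * B * adj U) = U * (A * B) * adj U"
    "(adj U * A * U) * (adj U * B * U) = adj U * (A * B) * U"
proof -
  have UU: "U * adj U = 1\<^sub>m n" using unitary_adj[OF U] .
  have "(U * A * adj U) * (U * B * adj U) = U * A * (adj U * U) * B * adj U"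
    using U(1) A B by (simp add: assoc_mult_mat[of _ n n _ n _ n] mult_carrier_mat[of _ n n _ n])
  thus "(U * A * adj U) * (U * B * adj U) = U * (A * B) * adj U"
    using U A B by (simp add: assoc_mult_mat[of _ n n _ n _ n] mult_carrier_mat[of _ n n _ n])
  have "(adj U * A * U) * (adj U * B * U) = adj U * A * (U * adj U) * B * U"
    using U(1) A B by (simp add: assoc_mult_mat[of _ n n _ n _ n] mult_carrier_mat[of _ n n _ n])
  thus "(adj U * A * U) * (adj U * B * U) = adj U * (A * B) * U"
    using U UU A B by (simp add: assoc_mult_mat[of _ n n _ n _ n] mult_carrier_mat[of _ n n _ n])
qed

lemma mtrace_unitary_conj:
  assumes U: "U \<in> carrier_mat n n" "adj U * U = 1\<^sub>m n" and A: "A \<in> carrier_mat n n"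
  shows "mtrace (U * A * adj U) = mtrace A" "mtrace (adj U * A * U) = mtrace A"
proof -
  have UU: "U * adj U = 1\<^sub>m n" using unitary_adj[OF U] .
  have "mtrace (U * A * adj U) = mtrace (adj U * (U * A))"
    using U A by (intro mtrace_mult_commute[of _ n n]) auto
  also have "adj U * (U * A) = (adj U * U) * A"
    using U(1) A by (simp add: assoc_mult_mat[of _ n n _ n _ n] mult_carrier_mat[of _ n n _ n])
  finally show "mtrace (U * A * adj U) = mtrace A" using U A by simp
  have "mtrace (adj U * A * U) = mtrace (U * (adj U * A))"
    using U A by (intro mtrace_mult_commute[of _ n n]) auto
  also have "U * (adj U * A) = (U * adj U) * A"
    using U(1) A by (simp add: assoc_mult_mat[of _ n n _ n _ n] mult_carrier_mat[of _ n n _ n])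
  finally show "mtrace (adj U * A * U) = mtrace A" using UU A by simp
qed

lemma conj_add:
  assumes "U \<in> carrier_mat m n" "A \<in> carrier_mat n n" "B \<in> carrier_mat n n" "V \<in> carrier_mat n m"
  shows "U * (A + B) * V = U * A * V + U * B * V"
  using assms add_mult_distrib_mat[of "U * A" m n "U * B" V m]
  by (simp add: mult_add_distrib_mat[of _ m n _ n])

lemma conj_minus:
  assumes "U \<in> carrier_mat m n" "A \<in> carrier_mat n n" "B \<in> carrier_mat n n" "V \<in> carrier_mat n m"
  shows "U * (A - B) * (V :: 'a :: ring mat) = U * A * V - U * B * V"
  using assms minus_mult_distrib_mat[of "U * A" m n "U * B" V m]
  by (simp add: mult_minus_distrib_mat[of _ m n _ n])

lemma psd_conj_diagm:
  assumes "U \<in> carrier_mat n n" "\<And>i. i < n \<Longrightarrow> 0 \<le> \<mu> i"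
  shows "psd n (U * diagm n \<mu> * adj U)"
  using psd_congruence[OF psd_diagm, of n \<mu> "adj U" n] assms by auto

text \<open>\<open>trace_norm\<close> is a definite description, so it can be evaluated only after
  existence and uniqueness of the positive root of \<open>adj X * X\<close> are known. Replacing
  each eigenvalue of \<open>X\<close> by its absolute value gives the root.\<close>

lemma trace_norm_diagonalized:
  assumes U: "U \<in> carrier_mat n n" "adj U * U = 1\<^sub>m n"
    and X: "X = U * diagm n \<mu> * adj U"
  shows "trace_norm X = (\<Sum>i<n. \<bar>\<mu> i\<bar>)"
proof -
  let ?P = "U * diagm n (\<lambda>i. \<bar>\<mu> i\<bar>) * adj U"
  have Xc: "X \<in> carrier_mat n n" using U X by auto
  have adjX: "adj X = X"
    using U unfolding X
    by (simp add: adj_mult[of U n n "diagm n \<mu> * adj U" n] adj_mult[of "diagm n \<mu>" n n "adj U" n]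
        assoc_mult_mat[of _ n n _ n _ n] mult_carrier_mat[of _ n n _ n])
  have XX: "adj X * X = U * diagm n (\<lambda>i. \<mu> i * \<mu> i) * adj U"
    unfolding adjX unfolding X using U by (simp add: unitary_conj_mult diagm_mult)
  have "(THE P. psd n P \<and> P * P = adj X * X) = ?P"
  proof (rule the_equality)
    show "psd n ?P \<and> ?P * ?P = adj X * X"
      unfolding XX using U by (auto intro!: psd_conj_diagm simp: unitary_conj_mult diagm_mult)
  next
    fix P assume P: "psd n P \<and> P * P = adj X * X"
    have Pc: "P \<in> carrier_mat n n" using P by (auto simp: psd_def)
    \<comment> \<open>In the eigenbasis of \<open>X\<close> any competitor becomes a positive root
      of a diagonal matrix, where \<open>psd_sqrt_diagm\<close> applies.\<close>
    let ?R = "adj U * P * U"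
    have "?R * ?R = adj U * (P * P) * U" using U Pc by (simp add: unitary_conj_mult)
    also have "\<dots> = diagm n (\<lambda>i. \<mu> i * \<mu> i)"
      using P U unfolding XX by (simp add: unitary_conj_cancel)
    finally have "?R = diagm n (\<lambda>i. \<bar>\<mu> i\<bar>)"
      using psd_sqrt_diagm psd_congruence[of n P U n] P U by blast
    thus "P = ?P" using unitary_conj_cancel(2)[OF U Pc] by simp
  qed
  thus ?thesis
    using Xc U by (simp add: trace_norm_def mtrace_unitary_conj mtrace_diagm)
qed

text \<open>The attained half of the characterization of the norm as a least trace. The witness is
  the absolute value of \<open>X\<close>: adding or subtracting \<open>X\<close> leaves the
  eigenvalues |\<mu>| + \<mu> or |\<mu>| - \<mu>, which are nonnegative.\<close>

lemma trace_norm_dominating: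
  assumes "X \<in> carrier_mat n n" "adj X = X"
  obtains P where "psd n (P + X)" "psd n (P - X)" "P \<in> carrier_mat n n" "trace_norm X = Re (mtrace P)"
proof -
  obtain U \<mu> where U: "U \<in> carrier_mat n n" "adj U * U = 1\<^sub>m n" and X: "X = U * diagm n \<mu> * adj U"
    using hermitian_diagonalization[OF assms] by blast
  let ?P = "U * diagm n (\<lambda>i. \<bar>\<mu> i\<bar>) * adj U"
  have "?P + X = U * diagm n (\<lambda>i. \<bar>\<mu> i\<bar> + \<mu> i) * adj U"
    unfolding X using U by (simp add: conj_add[of U n n, symmetric] diagm_add)
  moreover have "?P - X = U * diagm n (\<lambda>i. \<bar>\<mu> i\<bar> - \<mu> i) * adj U"
    unfolding X using U by (simp add: conj_minus[of U n n, symmetric] diagm_minus)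
  ultimately show ?thesis
    using U by (intro that[of ?P])
      (auto intro!: psd_conj_diagm simp: trace_norm_diagonalized[OF U X] mtrace_unitary_conj mtrace_diagm)
qed

text \<open>The minimality half. In the eigenbasis of \<open>X\<close> the diagonal entries of
  \<open>Q\<close> dominate the absolute eigenvalues, and the trace does not depend on the
  basis.\<close>

lemma trace_norm_le:
  assumes "X \<in> carrier_mat n n" "adj X = X" and Q: "Q \<in> carrier_mat n n" "psd n (Q + X)" "psd n (Q - X)"
  shows "trace_norm X \<le> Re (mtrace Q)"
proof -
  obtain U \<mu> where U: "U \<in> carrier_mat n n" "adj U * U = 1\<^sub>m n" and X: "X = U * diagm n \<mu> * adj U"
    using hermitian_diagonalization[OF assms(1,2)] by blast
  define R where "R = adj U * Q * U"
  have Rc: "R \<in> carrier_mat n n" using U Q by (auto simp: R_def)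
  have D: "adj U * X * U = diagm n \<mu>" unfolding X using U by (simp add: unitary_conj_cancel)
  have "adj U * (Q + X) * U = R + diagm n \<mu>" "adj U * (Q - X) * U = R - diagm n \<mu>"
    using conj_add[of "adj U" n n Q X U] conj_minus[of "adj U" n n Q X U] U Q assms(1)
    unfolding R_def D by auto
  hence "psd n (R + diagm n \<mu>)" "psd n (R - diagm n \<mu>)"
    using psd_congruence[OF Q(2) U(1)] psd_congruence[OF Q(3) U(1)] by auto
  hence "\<bar>\<mu> i\<bar> \<le> Re (R $$ (i,i))" if "i < n" for i
    using psd_diag_entry[of n "R + diagm n \<mu>" i] psd_diag_entry[of n "R - diagm n \<mu>" i] that Rc
    by auto
  hence "(\<Sum>i<n. \<bar>\<mu> i\<bar>) \<le> (\<Sum>i<n. Re (R $$ (i,i)))" by (intro sum_mono) auto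
  also have "\<dots> = Re (mtrace R)" using Rc by (simp add: mtrace_def)
  finally show ?thesis
    using U Q by (simp add: trace_norm_diagonalized[OF U X] mtrace_unitary_conj R_def)
qed

text \<open>Triangle inequality and unitary invariance in one step. If \<open>P\<close> dominates
  both \<open>M\<close> and \<open>-M\<close>, then \<open>Z * P * Z\<close> dominates both signs of
  \<open>Z * M * Z\<close>; the average of \<open>P\<close> and \<open>Z * P * Z\<close> therefore
  dominates the averaged difference, and its trace is that of \<open>P\<close>.\<close>

lemma trace_norm_reflection_le:
  assumes M: "M \<in> carrier_mat n n" "adj M = M"
    and Z: "Z \<in> carrier_mat n n" "adj Z = Z" "Z * Z = 1\<^sub>m n"
  shows "trace_norm ((1/2) \<cdot>\<^sub>m (M - Z * M * Z)) \<le> trace_norm M"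
proof -
  obtain P where P: "psd n (P + M)" "psd n (P - M)" "P \<in> carrier_mat n n" "trace_norm M = Re (mtrace P)"
    using trace_norm_dominating[OF M] by blast
  define M' where "M' = Z * M * Z"
  define P' where "P' = Z * P * Z"
  let ?X = "(1/2) \<cdot>\<^sub>m (M - M')"
  let ?Q = "(1/2) \<cdot>\<^sub>m (P + P')"
  have c: "M' \<in> carrier_mat n n" "P' \<in> carrier_mat n n" using M Z P by (auto simp: M'_def P'_def)
  have "adj M' = M'"
    using M Z by (simp add: M'_def adj_mult[of Z n n "M * Z" n] adj_mult[of M n n Z n]
        assoc_mult_mat[of _ n n _ n _ n] mult_carrier_mat[of _ n n _ n])
  hence adjX: "adj ?X = ?X" using M c by (simp add: adj_smult adj_minus[of _ n n])
  have "psd n (P' - M')" "psd n (P' + M')"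
    using psd_congruence[OF P(2) Z(1)] psd_congruence[OF P(1) Z(1)] M P Z(1)
    unfolding Z(2) M'_def P'_def by (auto simp: conj_minus[of Z n n P M Z] conj_add[of Z n n P M Z])
  \<comment> \<open>The signs are crossed because \<open>M'\<close> enters the difference
    negatively.\<close>
  from psd_smult[OF psd_add[OF P(1) this(1)], of "1/2"] psd_smult[OF psd_add[OF P(2) this(2)], of "1/2"]
  have psds: "psd n (complex_of_real (1/2) \<cdot>\<^sub>m ((P + M) + (P' - M')))"
    "psd n (complex_of_real (1/2) \<cdot>\<^sub>m ((P - M) + (P' + M')))" by auto
  have "?Q + ?X = complex_of_real (1/2) \<cdot>\<^sub>m ((P + M) + (P' - M'))"
    "?Q - ?X = complex_of_real (1/2) \<cdot>\<^sub>m ((P - M) + (P' + M'))"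
    using M P c by (auto intro!: eq_matI simp: algebra_simps)
  with psds have dom: "psd n (?Q + ?X)" "psd n (?Q - ?X)" by auto
  \<comment> \<open>A Hermitian involution is unitary, so conjugation by \<open>Z\<close> preserves
    the trace.\<close>
  have "mtrace P' = mtrace P"
    using mtrace_unitary_conj(1)[of Z n P] Z P by (simp add: P'_def)
  hence "mtrace ?Q = mtrace P"
    using P c by (simp add: mtrace_smult[of _ n] mtrace_add[of _ n])
  thus ?thesis
    using trace_norm_le[OF _ adjX _ dom] M P c minus_carrier_mat[of M' n n M] unfolding M'_def by auto
qed

text \<open>Since |v_i| |v_j| is at most |v|^2, the form of \<open>E\<close> at \<open>v\<close> is
  at most \<open>e\<close> times |v|^2 in modulus. The bound is crude, but it tends to 0 with the
  entries of \<open>E\<close>, which is what continuity needs.\<close>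

lemma psd_entry_bound:
  assumes E: "E \<in> carrier_mat n n" "adj E = E"
  defines "e \<equiv> \<Sum>i<n. \<Sum>j<n. cmod (E $$ (i,j))"
  shows "psd n (diagm n (\<lambda>_. e) + E)"
proof -
  have "0 \<le> Re (cinner v ((diagm n (\<lambda>_. e) + E) *\<^sub>v v))" if v: "v \<in> carrier_vec n" for v
  proof -
    define s where "s = (\<Sum>i<n. (cmod (v $ i))\<^sup>2)"
    have vi: "(cmod (v $ i))\<^sup>2 \<le> s" if "i < n" for i
      unfolding s_def using that by (intro member_le_sum) auto
    have "cinner v (diagm n (\<lambda>_. e) *\<^sub>v v) = complex_of_real (e * s)"
    proof -
      have "diagm n (\<lambda>_. e) *\<^sub>v v = complex_of_real e \<cdot>\<^sub>v v"
        using v by (auto simp: diagm_mult_vec intro!: eq_vecI)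
      thus ?thesis using v by (simp add: cinner_smult_right cinner_self s_def)
    qed
    hence *: "Re (cinner v ((diagm n (\<lambda>_. e) + E) *\<^sub>v v)) = e * s + Re (cinner v (E *\<^sub>v v))"
      using E v by (simp add: add_mult_distrib_mat_vec[of _ n n] cinner_add_right[of _ n]
          mult_mat_vec_carrier[of _ n n])
    have "cinner v (E *\<^sub>v v) = (\<Sum>i<n. \<Sum>j<n. cnj (v $ i) * (E $$ (i,j) * v $ j))"
      using E v by (auto simp: cinner_def mult_mat_vec_entry sum_distrib_left simp del: index_mult_mat_vec)
    hence "cmod (cinner v (E *\<^sub>v v)) \<le> (\<Sum>i<n. \<Sum>j<n. cmod (cnj (v $ i) * (E $$ (i,j) * v $ j)))"
      by (auto intro!: order_trans[OF norm_sum] sum_mono norm_sum)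
    also have "\<dots> \<le> (\<Sum>i<n. \<Sum>j<n. cmod (E $$ (i,j)) * s)"
    proof (intro sum_mono)
      fix i j assume ij: "i \<in> {..<n}" "j \<in> {..<n}"
      have "cmod (v $ i) * cmod (v $ j) \<le> ((cmod (v $ i))\<^sup>2 + (cmod (v $ j))\<^sup>2) / 2"
        using sum_squares_bound[of "cmod (v $ i)" "cmod (v $ j)"] by simp
      also have "\<dots> \<le> s" using vi[of i] vi[of j] ij by auto
      finally show "cmod (cnj (v $ i) * (E $$ (i,j) * v $ j)) \<le> cmod (E $$ (i,j)) * s"
        using mult_left_mono[of "cmod (v $ i) * cmod (v $ j)" s "cmod (E $$ (i,j))"]
        by (simp add: norm_mult mult.left_commute)
    qed
    also have "\<dots> = e * s" by (simp add: e_def sum_distrib_right)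
    finally have "cmod (cinner v (E *\<^sub>v v)) \<le> e * s" .
    with abs_Re_le_cmod[of "cinner v (E *\<^sub>v v)"] show ?thesis unfolding * by linarith
  qed
  thus ?thesis using E by (auto simp: psd_iff adj_add[of _ n n])
qed

text \<open>If \<open>P\<close> dominates \<open>X\<close>, then \<open>P\<close> plus
  \<open>e\<close> times the identity dominates \<open>Y\<close>, at the cost of
  \<open>n * e\<close> in the trace. Used in both directions, this makes the norm Lipschitz in the
  entries.\<close>

lemma trace_norm_diff_le:
  assumes X: "X \<in> carrier_mat n n" "adj X = X" and Y: "Y \<in> carrier_mat n n" "adj Y = Y"
  shows "trace_norm Y \<le> trace_norm X + n * (\<Sum>i<n. \<Sum>j<n. cmod (Y $$ (i,j) - X $$ (i,j)))"
proof -
  obtain P where P: "psd n (P + X)" "psd n (P - X)" "P \<in> carrier_mat n n" "trace_norm X = Re (mtrace P)"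
    using trace_norm_dominating[OF X] by blast
  define e where "e = (\<Sum>i<n. \<Sum>j<n. cmod (Y $$ (i,j) - X $$ (i,j)))"
  let ?D = "diagm n (\<lambda>_. e)"
  have "psd n (?D + (Y - X))"
    using psd_entry_bound[of "Y - X" n] X Y by (simp add: e_def adj_minus[of _ n n] minus_carrier_mat)
  from psd_add[OF P(1) this] have 1: "psd n ((P + X) + (?D + (Y - X)))" .
  have "psd n (?D + (X - Y))"
    using psd_entry_bound[of "X - Y" n] X Y by (simp add: e_def adj_minus[of _ n n] minus_carrier_mat norm_minus_commute)
  from psd_add[OF P(2) this] have 2: "psd n ((P - X) + (?D + (X - Y)))" .
  have "trace_norm Y \<le> Re (mtrace (P + ?D))"
  proof (rule trace_norm_le[OF Y])
    have "(P + X) + (?D + (Y - X)) = (P + ?D) + Y" "(P - X) + (?D + (X - Y)) = (P + ?D) - Y"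
      using X Y P by (auto intro!: eq_matI)
    thus "psd n ((P + ?D) + Y)" "psd n ((P + ?D) - Y)" using 1 2 by auto
  qed (use P in auto)
  also have "mtrace (P + ?D) = mtrace P + complex_of_real (n * e)"
    using P by (simp add: mtrace_add[of _ n] mtrace_diagm)
  finally show ?thesis using P by (simp add: e_def)
qed

section \<open>Kronecker products and dephasing\<close>

lemma kron_carrier [simp, intro]:
  "A \<in> carrier_mat n m \<Longrightarrow> B \<in> carrier_mat p q \<Longrightarrow> kron A B \<in> carrier_mat (n * p) (m * q)"
  by (auto simp: kron_def)

lemma kron_dim [simp]:
  "dim_row (kron A B) = dim_row A * dim_row B" "dim_col (kron A B) = dim_col A * dim_col B"
  by (auto simp: kron_def)

lemma kron_index:
  assumes "A \<in> carrier_mat n m" "B \<in> carrier_mat p q" "i < n * p" "j < m * q"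
  shows "kron A B $$ (i,j) = A $$ (i div p, j div q) * B $$ (i mod p, j mod q)"
  using assms by (auto simp: kron_def)

lemma div_mod_less:
  fixes i n p :: nat
  assumes "i < n * p"
  shows "i div p < n" "i mod p < p"
proof -
  have "p > 0" using assms by (cases p) auto
  thus "i div p < n" "i mod p < p" using assms by (auto simp: less_mult_imp_div_less)
qed

text \<open>Splits a composite index in the same way as the \<open>div\<close> and
  \<open>mod\<close> encoding of \<open>kron\<close>.\<close>

lemma sum_lessThan_mult:
  fixes f :: "nat \<Rightarrow> 'a::comm_monoid_add"
  shows "(\<Sum>l<m * q. f l) = (\<Sum>a<m. \<Sum>b<q. f (a * q + b))"
proof -
  have "(\<Sum>l<m * q. f l) = (\<Sum>a<m. sum f {a * q..<a * q + q})"
    by (rule sum.nat_group[symmetric])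
  also have "\<dots> = (\<Sum>a<m. \<Sum>b<q. f (a * q + b))"
    by (simp add: sum.atLeastLessThan_shift_0[of f] lessThan_atLeast0 add.commute)
  finally show ?thesis .
qed

lemma kron_mult:
  assumes A: "A \<in> carrier_mat n m" and B: "B \<in> carrier_mat p q"
    and C: "C \<in> carrier_mat m k" and D: "D \<in> carrier_mat q r"
  shows "kron A B * kron C D = kron (A * C) (B * D)"
proof (intro eq_matI)
  fix i j assume "i < dim_row (kron (A * C) (B * D))" "j < dim_col (kron (A * C) (B * D))"
  hence ij: "i < n * p" "j < k * r" using assms by auto
  note dm = div_mod_less[OF ij(1)] div_mod_less[OF ij(2)]
  have "(kron A B * kron C D) $$ (i,j) = (\<Sum>l<m * q. kron A B $$ (i,l) * kron C D $$ (l,j))"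
    using assms ij by (intro mult_mat_entry) auto
  also have "\<dots> = (\<Sum>a<m. \<Sum>b<q. (A $$ (i div p, a) * B $$ (i mod p, b)) * (C $$ (a, j div r) * D $$ (b, j mod r)))"
    unfolding sum_lessThan_mult
  proof (intro sum.cong refl)
    fix a b assume "a \<in> {..<m}" "b \<in> {..<q}"
    \<comment> \<open>From \<open>Suc a \<le> m\<close> it follows that a q + b < (a + 1) q, which
      is at most m q.\<close>
    moreover from this have "a * q + b < m * q"
      by (auto simp: less_eq_Suc_le[of a] dest!: mult_le_mono1[of "Suc a" m q])
    ultimately show "kron A B $$ (i, a * q + b) * kron C D $$ (a * q + b, j)
        = (A $$ (i div p, a) * B $$ (i mod p, b)) * (C $$ (a, j div r) * D $$ (b, j mod r))"
      using ij by (simp add: kron_index[OF A B] kron_index[OF C D])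
  qed
  also have "\<dots> = (\<Sum>a<m. A $$ (i div p, a) * C $$ (a, j div r)) * (\<Sum>b<q. B $$ (i mod p, b) * D $$ (b, j mod r))"
    by (simp add: sum_product mult_ac)
  also have "\<dots> = (A * C) $$ (i div p, j div r) * (B * D) $$ (i mod p, j mod r)"
    using dm assms by (simp add: mult_mat_entry[OF A C] mult_mat_entry[OF B D] del: index_mult_mat(1))
  also have "\<dots> = kron (A * C) (B * D) $$ (i,j)"
    using ij assms by (subst kron_index[of _ n k _ p r]) auto
  finally show "(kron A B * kron C D) $$ (i,j) = kron (A * C) (B * D) $$ (i,j)" .
qed (use assms in auto)

lemma adj_kron: "adj (kron A B) = kron (adj A) (adj B)"
proof (intro eq_matI)
  fix i j assume "i < dim_row (kron (adj A) (adj B))" "j < dim_col (kron (adj A) (adj B))"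
  hence "i < dim_col A * dim_col B" "j < dim_row A * dim_row B" by auto
  thus "adj (kron A B) $$ (i,j) = kron (adj A) (adj B) $$ (i,j)"
    using div_mod_less[of i "dim_col A" "dim_col B"] div_mod_less[of j "dim_row A" "dim_row B"]
    by (auto simp: kron_def)
qed auto

lemma kron_add_left:
  assumes "A \<in> carrier_mat n m" "B \<in> carrier_mat n m" "C \<in> carrier_mat p q"
  shows "kron (A + B) C = kron A C + kron B C"
proof (intro eq_matI)
  fix i j assume "i < dim_row (kron A C + kron B C)" "j < dim_col (kron A C + kron B C)"
  hence "i < n * p" "j < m * q" using assms by auto
  thus "kron (A + B) C $$ (i,j) = (kron A C + kron B C) $$ (i,j)"
    using assms div_mod_less[of i n p] div_mod_less[of j m q]
    by (auto simp: kron_def algebra_simps)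
qed (use assms in auto)

lemma kron_one: "kron (1\<^sub>m n) (1\<^sub>m p) = 1\<^sub>m (n * p)"
proof (intro eq_matI)
  fix i j assume "i < dim_row (1\<^sub>m (n * p))" "j < dim_col (1\<^sub>m (n * p))"
  hence ij: "i < n * p" "j < n * p" by auto
  have "i = j \<longleftrightarrow> i div p = j div p \<and> i mod p = j mod p"
    by (metis div_mult_mod_eq)
  thus "kron (1\<^sub>m n) (1\<^sub>m p) $$ (i,j) = 1\<^sub>m (n * p) $$ (i,j)"
    using ij div_mod_less[of i n p] div_mod_less[of j n p] by (auto simp: kron_def)
qed auto

lemma kron_one_left: "kron (1\<^sub>m 1) A = A"
proof (intro eq_matI)
  fix i j assume "i < dim_row A" "j < dim_col A"
  thus "kron (1\<^sub>m 1) A $$ (i,j) = A $$ (i,j)" by (auto simp: kron_def)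
qed auto

lemma kron_zero_left: "kron (0\<^sub>m n m) A = 0\<^sub>m (n * dim_row A) (m * dim_col A)"
proof (intro eq_matI)
  fix i j assume "i < dim_row (0\<^sub>m (n * dim_row A) (m * dim_col A))" "j < dim_col (0\<^sub>m (n * dim_row A) (m * dim_col A))"
  thus "kron (0\<^sub>m n m) A $$ (i,j) = 0\<^sub>m (n * dim_row A) (m * dim_col A) $$ (i,j)"
    using div_mod_less[of i n "dim_row A"] div_mod_less[of j m "dim_col A"]
    by (auto simp: kron_def)
qed auto

text \<open>A one-column matrix, so that bras and kets multiply as matrices and
  \<open>kron (ket a) (1\<^sub>m d)\<close> maps B into the composite system.\<close>

definition ket :: "complex vec \<Rightarrow> complex mat" where
  "ket a = mat (dim_vec a) 1 (\<lambda>(i,j). a $ i)"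

lemma ket_carrier [simp, intro]: "a \<in> carrier_vec n \<Longrightarrow> ket a \<in> carrier_mat n 1"
  by (auto simp: ket_def)

text \<open>The variant of \<open>ket_carrier\<close> that still matches once the simplifier has
  rewritten \<open>1\<close> to \<open>Suc 0\<close>.\<close>

lemma ket_carrier_Suc [simp]: "a \<in> carrier_vec n \<Longrightarrow> ket a \<in> carrier_mat n (Suc 0)"
  by (auto simp: ket_def)

lemma ketbra_carrier [simp, intro]: "a \<in> carrier_vec n \<Longrightarrow> ketbra a \<in> carrier_mat n n"
  by (auto simp: ketbra_def)

lemma adj_ketbra [simp]: "adj (ketbra a) = ketbra a"
  by (intro eq_matI) (auto simp: ketbra_def)

lemma ketbra_ket:
  assumes "a \<in> carrier_vec n"
  shows "ketbra a = ket a * adj (ket a)"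
  using assms by (intro eq_matI) (auto simp: ketbra_def ket_def scalar_prod_def)

lemma bra_ket:
  assumes "a \<in> carrier_vec 2" "b \<in> carrier_vec 2"
  shows "adj (ket a) * ket b = inner2 a b \<cdot>\<^sub>m 1\<^sub>m 1"
  using assms by (intro eq_matI)
    (auto simp: ket_def scalar_prod_def inner2_def lessThan_atLeast0)

lemma inner2_swap: "inner2 b a = cnj (inner2 a b)"
  by (simp add: inner2_def mult.commute)

lemma mult_mat_assoc4:
  assumes "A \<in> carrier_mat n m" "B \<in> carrier_mat m k" "C \<in> carrier_mat k l" "D \<in> carrier_mat l p"
  shows "A * B * (C * D) = A * (B * C) * D"
  using assms assoc_mult_mat[of A n m B k "C * D" p] assoc_mult_mat[of B m k C l D p]
    assoc_mult_mat[of A n m "B * C" l D p] mult_carrier_mat[of C k l D p] mult_carrier_mat[of B m k C l]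
  by simp

lemma ketbra_mult:
  assumes "a \<in> carrier_vec 2" "b \<in> carrier_vec 2"
  shows "ketbra a * ketbra b = inner2 a b \<cdot>\<^sub>m (ket a * adj (ket b))"
proof -
  have c: "ket a \<in> carrier_mat 2 1" "ket b \<in> carrier_mat 2 1"
    "adj (ket a) \<in> carrier_mat 1 2" "adj (ket b) \<in> carrier_mat 1 2" using assms by auto
  have "ketbra a * ketbra b = ket a * (adj (ket a) * ket b) * adj (ket b)"
    unfolding ketbra_ket[OF assms(1)] ketbra_ket[OF assms(2)]
    by (rule mult_mat_assoc4[OF c(1,3,2,4)])
  also have "\<dots> = inner2 a b \<cdot>\<^sub>m (ket a * adj (ket b))"
    unfolding bra_ket[OF assms] mult_smult_distrib[OF c(1) one_carrier_mat] right_mult_one_mat[OF c(1)]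
    by (rule mult_smult_assoc_mat[OF c(1) c(4)])
  finally show ?thesis .
qed

section \<open>Dephasing in a fixed orthonormal basis of the qubit\<close>

locale qubit_onb =
  fixes a0 a1 :: "complex vec" and d :: nat
  assumes onb: "onb2 a0 a1"
begin

lemma carriers [simp, intro]: "a0 \<in> carrier_vec 2" "a1 \<in> carrier_vec 2"
  using onb by (auto simp: onb2_def)

lemma ketbra_products [simp]:
  "ketbra a0 * ketbra a0 = ketbra a0" "ketbra a1 * ketbra a1 = ketbra a1"
  "ketbra a0 * ketbra a1 = 0\<^sub>m 2 2" "ketbra a1 * ketbra a0 = 0\<^sub>m 2 2"
proof -
  have i: "inner2 a0 a0 = 1" "inner2 a1 a1 = 1" "inner2 a0 a1 = 0" "inner2 a1 a0 = 0"
    using onb inner2_swap[of a1 a0] by (auto simp: onb2_def)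
  have c: "ket a0 * adj (ket a1) \<in> carrier_mat 2 2" "ket a1 * adj (ket a0) \<in> carrier_mat 2 2"
    by (auto intro!: mult_carrier_mat[of _ 2 1])
  have one: "(1::complex) \<cdot>\<^sub>m A = A" for A by (intro eq_matI) auto
  show "ketbra a0 * ketbra a0 = ketbra a0"
    using ketbra_mult[of a0 a0] ketbra_ket[of a0 2] by (simp add: i one)
  show "ketbra a1 * ketbra a1 = ketbra a1"
    using ketbra_mult[of a1 a1] ketbra_ket[of a1 2] by (simp add: i one)
  have zero: "(0::complex) \<cdot>\<^sub>m A = 0\<^sub>m 2 2" if "A \<in> carrier_mat 2 2" for A
    using that by (intro eq_matI) auto
  show "ketbra a0 * ketbra a1 = 0\<^sub>m 2 2" "ketbra a1 * ketbra a0 = 0\<^sub>m 2 2"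
    using c by (simp_all add: ketbra_mult i zero)
qed

text \<open>Let \<open>U\<close> have columns \<open>a0\<close> and \<open>a1\<close>.
  Orthonormality says \<open>adj U * U\<close> is the identity; for a square matrix the reversed
  product is then the identity as well, and this is completeness.\<close>

lemma ketbra_sum: "ketbra a0 + ketbra a1 = 1\<^sub>m 2"
proof -
  define U where "U = mat 2 2 (\<lambda>(i,j). if j = 0 then a0 $ i else a1 $ i)"
  have U: "U \<in> carrier_mat 2 2" by (simp add: U_def)
  have two: "{0..<2} = {0, Suc 0}" "{..<2} = {0, Suc 0}" by auto
  have i: "inner2 a0 a0 = 1" "inner2 a1 a1 = 1" "inner2 a0 a1 = 0" "inner2 a1 a0 = 0"
    using onb inner2_swap[of a1 a0] by (auto simp: onb2_def)
  have "(adj U * U) $$ (i,j) = 1\<^sub>m 2 $$ (i,j)" if "i < 2" "j < 2" for i j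
  proof -
    have "(adj U * U) $$ (i,j) = inner2 (if i = 0 then a0 else a1) (if j = 0 then a0 else a1)"
      using that U by (auto simp: U_def scalar_prod_def inner2_def two)
    thus ?thesis using i that by (auto simp: less_2_cases_iff)
  qed
  hence "adj U * U = 1\<^sub>m 2" using U by (intro eq_matI) auto
  hence "U * adj U = 1\<^sub>m 2" using unitary_adj[OF U] by simp
  moreover have "U * adj U = ketbra a0 + ketbra a1"
    by (intro eq_matI) (auto simp: carriers[THEN carrier_vecD] U_def ketbra_def scalar_prod_def two)
  ultimately show ?thesis by simp
qed

definition K0 where "K0 = kron (ketbra a0) (1\<^sub>m d)"
definition K1 where "K1 = kron (ketbra a1) (1\<^sub>m d)"

lemma K_carrier [simp, intro]: "K0 \<in> carrier_mat (2*d) (2*d)" "K1 \<in> carrier_mat (2*d) (2*d)"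
  by (auto simp: K0_def K1_def)

text \<open>The inner size of a product cannot be read off a carrier goal, so all sizes are fixed in
  advance.\<close>

lemmas [simp] = mult_carrier_mat[of _ "2*d" "2*d" _ "2*d"] minus_carrier_mat[of _ "2*d" "2*d"]

lemma adj_K [simp]: "adj K0 = K0" "adj K1 = K1"
  by (simp_all add: K0_def K1_def adj_kron)

lemma K_sum: "K0 + K1 = 1\<^sub>m (2*d)"
  unfolding K0_def K1_def using kron_add_left[of "ketbra a0" 2 2 "ketbra a1" "1\<^sub>m d" d d]
  by (simp add: ketbra_sum kron_one)

lemma K_products [simp]: "K0 * K0 = K0" "K1 * K1 = K1"
  "K0 * K1 = 0\<^sub>m (2*d) (2*d)" "K1 * K0 = 0\<^sub>m (2*d) (2*d)"
  unfolding K0_def K1_def by (simp_all add: kron_mult[of _ 2 2 _ d d _ 2 _ d] kron_zero_left)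

lemma dephase_K: "dephase d a0 a1 X = K0 * X * K0 + K1 * X * K1"
  by (simp add: dephase_def K0_def K1_def)

lemma dephase_carrier [simp, intro]:
  "X \<in> carrier_mat (2*d) (2*d) \<Longrightarrow> dephase d a0 a1 X \<in> carrier_mat (2*d) (2*d)"
  by (auto simp: dephase_K)

lemma adj_dephase:
  assumes "X \<in> carrier_mat (2*d) (2*d)" "adj X = X"
  shows "adj (dephase d a0 a1 X) = dephase d a0 a1 X"
proof -
  have "adj (K * X * K) = K * X * K" if "K \<in> carrier_mat (2*d) (2*d)" "adj K = K" for K
    using assms that by (simp add: adj_mult[of K "2*d" "2*d" "X * K" "2*d"] adj_mult[of X "2*d" "2*d" K "2*d"]
        assoc_mult_mat[of _ "2*d" "2*d" _ "2*d" _ "2*d"] mult_carrier_mat[of _ "2*d" "2*d" _ "2*d"])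
  from this[of K0] this[of K1] show ?thesis using assms unfolding dephase_K
    by (subst adj_add[of _ "2*d" "2*d"]) (simp_all del: assoc_mult_mat)
qed

lemma dephase_minus:
  assumes "X \<in> carrier_mat (2*d) (2*d)" "Y \<in> carrier_mat (2*d) (2*d)"
  shows "dephase d a0 a1 (X - Y) = dephase d a0 a1 X - dephase d a0 a1 Y"
proof -
  have "K * (X - Y) * K = K * X * K - K * Y * K" if "K \<in> carrier_mat (2*d) (2*d)" for K
    using that assms by (intro conj_minus) auto
  moreover have "K * X * K \<in> carrier_mat (2*d) (2*d)" "K * Y * K \<in> carrier_mat (2*d) (2*d)"
    if "K \<in> carrier_mat (2*d) (2*d)" for K
    using that assms by auto
  moreover have "(A - B) + (C - D) = (A + C) - (B + D)"
    if "A \<in> carrier_mat (2*d) (2*d)" "B \<in> carrier_mat (2*d) (2*d)" "C \<in> carrier_mat (2*d) (2*d)"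
      "D \<in> carrier_mat (2*d) (2*d)" for A B C D :: "complex mat"
    using that by (intro eq_matI) auto
  ultimately show ?thesis unfolding dephase_K by simp
qed

definition Z where "Z = K0 - K1"

lemma Z_carrier [simp, intro]: "Z \<in> carrier_mat (2*d) (2*d)"
  by (auto simp: Z_def intro!: minus_carrier_mat)

lemma adj_Z: "adj Z = Z"
  by (simp add: Z_def adj_minus[of _ "2*d" "2*d"])

lemma Z_sq: "Z * Z = 1\<^sub>m (2*d)"
proof -
  have "Z * Z = (K0 * K0 - K1 * K0) - (K0 * K1 - K1 * K1)"
    unfolding Z_def
    by (subst mult_minus_distrib_mat[of _ "2*d" "2*d" _ "2*d"])
      (auto simp del: K_products simp: minus_mult_distrib_mat[of _ "2*d" "2*d" _ _ "2*d"])
  also have "\<dots> = K0 + K1"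
    by (intro eq_matI) (auto simp: K_products K_carrier[THEN carrier_matD(1)] K_carrier[THEN carrier_matD(2)])
  finally show ?thesis using K_sum by simp
qed

text \<open>Cut \<open>M\<close> into four blocks by \<open>K0\<close> and \<open>K1\<close>.
  Conjugation by \<open>Z\<close> flips the sign of the two off-diagonal blocks and dephasing
  removes them, so both sides equal \<open>M01 + M10\<close>.\<close>

lemma minus_dephase_reflection:
  assumes M: "M \<in> carrier_mat (2*d) (2*d)"
  shows "M - dephase d a0 a1 M = (1/2) \<cdot>\<^sub>m (M - Z * M * Z)"
proof -
  let ?n = "2*d"
  define M00 M01 M10 M11 where defs: "M00 = K0 * M * K0" "M01 = K0 * M * K1" "M10 = K1 * M * K0" "M11 = K1 * M * K1"
  have c: "M00 \<in> carrier_mat ?n ?n" "M01 \<in> carrier_mat ?n ?n" "M10 \<in> carrier_mat ?n ?n" "M11 \<in> carrier_mat ?n ?n"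
    using M by (auto simp: defs)
  have KM: "K0 * M \<in> carrier_mat ?n ?n" "K1 * M \<in> carrier_mat ?n ?n" using M by auto
  have "M = (K0 + K1) * M * (K0 + K1)" using M by (simp add: K_sum)
  also have "\<dots> = (K0 * M + K1 * M) * (K0 + K1)"
    using M by (subst add_mult_distrib_mat[of _ ?n ?n]) auto
  also have "\<dots> = (K0 * M + K1 * M) * K0 + (K0 * M + K1 * M) * K1"
    using KM by (subst mult_add_distrib_mat[of _ ?n ?n _ ?n]) auto
  also have "\<dots> = (M00 + M10) + (M01 + M11)"
    unfolding defs using KM by (simp add: add_mult_distrib_mat[of _ ?n ?n _ _ ?n])
  finally have 1: "M = (M00 + M10) + (M01 + M11)" .
  have "Z * M * Z = (K0 * M - K1 * M) * (K0 - K1)"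
    unfolding Z_def using M by (subst minus_mult_distrib_mat[of _ ?n ?n]) auto
  also have "\<dots> = (K0 * M - K1 * M) * K0 - (K0 * M - K1 * M) * K1"
    using KM minus_carrier_mat[OF KM(2)] by (subst mult_minus_distrib_mat[of _ ?n ?n _ ?n]) auto
  also have "\<dots> = (M00 - M10) - (M01 - M11)"
    unfolding defs using KM by (simp add: minus_mult_distrib_mat[of _ ?n ?n _ _ ?n])
  finally have 2: "Z * M * Z = (M00 - M10) - (M01 - M11)" .
  have 3: "dephase d a0 a1 M = M00 + M11" by (simp add: dephase_K defs)
  have "S - (M00 + M11) = (1/2) \<cdot>\<^sub>m (S - ((M00 - M10) - (M01 - M11)))"
    if S: "S = (M00 + M10) + (M01 + M11)" for S
    unfolding S using c by (auto intro!: eq_matI)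
  from this[OF 1] show ?thesis unfolding 2 3 .
qed

lemma trace_norm_minus_dephase_le:
  assumes "M \<in> carrier_mat (2*d) (2*d)" "adj M = M"
  shows "trace_norm (M - dephase d a0 a1 M) \<le> trace_norm M"
  unfolding minus_dephase_reflection[OF assms(1)]
  by (rule trace_norm_reflection_le[OF assms Z_carrier adj_Z Z_sq])

text \<open>Each of \<open>K0\<close> and \<open>K1\<close> fixes its own summand from both sides
  and annihilates the other.\<close>

lemma dephase_cq:
  assumes s: "s0 \<in> carrier_mat d d" "s1 \<in> carrier_mat d d"
  shows "dephase d a0 a1 (kron (ketbra a0) s0 + kron (ketbra a1) s1)
      = kron (ketbra a0) s0 + kron (ketbra a1) s1"
proof -
  let ?A = "kron (ketbra a0) s0" and ?B = "kron (ketbra a1) s1"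
  have AB: "?A \<in> carrier_mat (2*d) (2*d)" "?B \<in> carrier_mat (2*d) (2*d)" using s by auto
  have "K0 * ?A = ?A" "?A * K0 = ?A" "K1 * ?B = ?B" "?B * K1 = ?B"
    "K0 * ?B = 0\<^sub>m (2*d) (2*d)" "K1 * ?A = 0\<^sub>m (2*d) (2*d)"
    unfolding K0_def K1_def using s by (simp_all add: kron_mult[of _ 2 2 _ d d _ 2 _ d] kron_zero_left)
  thus ?thesis unfolding dephase_K
    using AB by (simp add: conj_add[of _ "2*d" "2*d"] left_mult_zero_mat[OF K_carrier(1)]
        left_mult_zero_mat[OF K_carrier(2)])
qed

text \<open>Factor the projection as \<open>V * adj V\<close>. Then the sandwich is V (V* X V) V*,
  whose middle factor acts on B alone; its trace follows by cyclicity. This exhibits the conditional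
  operators of a dephased state.\<close>

lemma sandwich_ketbra:
  assumes a: "a \<in> carrier_vec 2" and X: "X \<in> carrier_mat (2*d) (2*d)"
  defines "V \<equiv> kron (ket a) (1\<^sub>m d)"
  shows "kron (ketbra a) (1\<^sub>m d) * X * kron (ketbra a) (1\<^sub>m d) = kron (ketbra a) (adj V * X * V)"
    and "mtrace (adj V * X * V) = mtrace (kron (ketbra a) (1\<^sub>m d) * X)"
proof -
  let ?n = "2*d"
  let ?s = "adj V * X * V"
  have V: "V \<in> carrier_mat ?n d" unfolding V_def using kron_carrier[OF ket_carrier[OF a], of "1\<^sub>m d" d d] by simp
  have adjV: "adj V = kron (adj (ket a)) (1\<^sub>m d)" unfolding V_def by (simp add: adj_kron)
  have s: "?s \<in> carrier_mat d d" using V X by auto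
  have K: "kron (ketbra a) (1\<^sub>m d) = V * adj V"
    unfolding adjV unfolding V_def ketbra_ket[OF a]
    using a by (subst kron_mult[of _ 2 1 _ d d _ 2 _ d]) auto
  have "kron (ketbra a) ?s = kron (ket a * adj (ket a)) (1\<^sub>m d * ?s)"
    unfolding left_mult_one_mat[OF s] ketbra_ket[OF a] ..
  also have "\<dots> = V * kron (adj (ket a)) ?s"
    unfolding V_def using a s by (subst kron_mult[of _ 2 1 _ d d _ 2 _ d]) (auto simp: V_def)
  \<comment> \<open>Reading \<open>?s\<close> as a Kronecker product with the 1 by 1 identity brings
    it within reach of \<open>kron_mult\<close>.\<close>
  also have "kron (adj (ket a)) ?s = kron (1\<^sub>m 1) ?s * adj V"
  proof -
    have "kron (1\<^sub>m 1) S * kron (adj (ket a)) (1\<^sub>m d) = kron (adj (ket a)) S"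
      if S: "S \<in> carrier_mat d d" for S
      unfolding kron_mult[OF one_carrier_mat S adj_carrier[OF ket_carrier[OF a]] one_carrier_mat]
        left_mult_one_mat[OF adj_carrier[OF ket_carrier[OF a]]] right_mult_one_mat[OF S] ..
    from this[OF s] show ?thesis unfolding adjV ..
  qed
  also have "kron (1\<^sub>m 1) ?s = ?s" by (rule kron_one_left)
  finally have "kron (ketbra a) ?s = V * (?s * adj V)" .
  also have "\<dots> = (V * adj V) * X * (V * adj V)"
  proof -
    have aV: "adj V \<in> carrier_mat d ?n" using V by auto
    have "?s * adj V = adj V * X * (V * adj V)"
      using V aV X by (intro assoc_mult_mat[of _ d ?n _ d _ ?n]) auto
    also have "\<dots> = adj V * (X * (V * adj V))"
      using V aV X by (intro assoc_mult_mat[of _ d ?n _ ?n _ ?n]) auto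
    also have "V * \<dots> = (V * adj V) * (X * (V * adj V))"
      using V aV X by (intro assoc_mult_mat[of _ ?n d _ ?n _ ?n, symmetric]) auto
    also have "\<dots> = (V * adj V) * X * (V * adj V)"
      using V aV X by (intro assoc_mult_mat[of _ ?n ?n _ ?n _ ?n, symmetric]) auto
    finally show ?thesis .
  qed
  finally show "kron (ketbra a) (1\<^sub>m d) * X * kron (ketbra a) (1\<^sub>m d) = kron (ketbra a) ?s"
    unfolding K by simp
  have "mtrace ?s = mtrace (V * (adj V * X))"
    using V X by (intro mtrace_mult_commute[of _ d ?n]) auto
  also have "V * (adj V * X) = V * adj V * X"
    using V X by (intro assoc_mult_mat[of _ ?n d _ ?n _ ?n, symmetric]) auto
  finally show "mtrace ?s = mtrace (kron (ketbra a) (1\<^sub>m d) * X)" unfolding K .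
qed

text \<open>The blocks on B are positive as congruences of \<open>\<rho>\<close>, and their traces
  add up to 1 because \<open>K0 + K1\<close> is the identity.\<close>

lemma cq_state_dephase:
  assumes "density_state (2*d) \<rho>"
  shows "cq_state d (dephase d a0 a1 \<rho>)"
proof -
  have psd: "psd (2*d) \<rho>" and tr: "mtrace \<rho> = 1" using assms by (auto simp: density_state_def)
  have c: "\<rho> \<in> carrier_mat (2*d) (2*d)" using psd by (rule psd_carrier)
  define s where "s a = adj (kron (ket a) (1\<^sub>m d)) * \<rho> * kron (ket a) (1\<^sub>m d)" for a
  have psds: "psd d (s a)" if "a \<in> carrier_vec 2" for a
    unfolding s_def using kron_carrier[OF ket_carrier[OF that], of "1\<^sub>m d" d d]
    by (intro psd_congruence[OF psd]) simp
  have "mtrace (s a0) + mtrace (s a1) = mtrace (K0 * \<rho>) + mtrace (K1 * \<rho>)"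
    unfolding s_def K0_def K1_def using sandwich_ketbra(2)[OF _ c] by simp
  also have "\<dots> = mtrace ((K0 + K1) * \<rho>)"
    using c by (subst add_mult_distrib_mat[of _ "2*d" "2*d"]) (auto simp: mtrace_add[of _ "2*d"])
  also have "\<dots> = 1" using c tr by (simp add: K_sum)
  finally have "mtrace (s a0) + mtrace (s a1) = 1" .
  moreover have "dephase d a0 a1 \<rho> = kron (ketbra a0) (s a0) + kron (ketbra a1) (s a1)"
    unfolding s_def dephase_def using sandwich_ketbra(1)[OF _ c] by simp
  ultimately show ?thesis unfolding cq_state_def
    using onb psds carriers by blast
qed

end

text \<open>Stated outside the locale because the basis is dictated by \<open>\<sigma>\<close> and
  changes with it.\<close>

lemma trace_norm_minus_dephase_le_cq:
  assumes \<rho>: "\<rho> \<in> carrier_mat (2*d) (2*d)" "adj \<rho> = \<rho>"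
    and onb: "onb2 a0 a1" and s: "psd d s0" "psd d s1"
    and \<sigma>: "\<sigma> = kron (ketbra a0) s0 + kron (ketbra a1) s1"
  shows "trace_norm (\<rho> - dephase d a0 a1 \<rho>) \<le> trace_norm (\<rho> - \<sigma>)"
proof -
  interpret qubit_onb a0 a1 d by unfold_locales (rule onb)
  have sc: "s0 \<in> carrier_mat d d" "s1 \<in> carrier_mat d d" "adj s0 = s0" "adj s1 = s1"
    using s by (auto simp: psd_def)
  have \<sigma>c: "\<sigma> \<in> carrier_mat (2*d) (2*d)" unfolding \<sigma> using sc by auto
  have "adj \<sigma> = \<sigma>" unfolding \<sigma> using sc
    by (subst adj_add[of _ "2*d" "2*d"]) (auto simp: adj_kron)
  hence "adj (\<rho> - \<sigma>) = \<rho> - \<sigma>" using \<rho> \<sigma>c by (simp add: adj_minus[of _ "2*d" "2*d"])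
  moreover have "\<rho> - \<sigma> - dephase d a0 a1 (\<rho> - \<sigma>) = \<rho> - dephase d a0 a1 \<rho>"
  proof -
    define D where "D = dephase d a0 a1 \<rho>"
    have D: "D \<in> carrier_mat (2*d) (2*d)" unfolding D_def using \<rho> by simp
    have "dephase d a0 a1 (\<rho> - \<sigma>) = D - \<sigma>"
      using dephase_minus[OF \<rho>(1) \<sigma>c] dephase_cq[OF sc(1,2)] by (simp add: \<sigma> D_def)
    moreover have "\<rho> - \<sigma> - (D - \<sigma>) = \<rho> - D" using \<rho> \<sigma>c D by (auto intro!: eq_matI)
    ultimately show ?thesis unfolding D_def by simp
  qed
  ultimately show ?thesis
    using trace_norm_minus_dephase_le[of "\<rho> - \<sigma>"] \<rho> \<sigma>c minus_carrier_mat[OF \<sigma>c] by simp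
qed

section \<open>Existence of an optimal basis\<close>

text \<open>The two directions of \<open>trace_norm_diff_le\<close> squeeze the change of the norm
  below a multiple of the sum of entrywise changes, which tends to 0.\<close>

lemma continuous_on_trace_norm:
  fixes F :: "'a::metric_space \<Rightarrow> complex mat"
  assumes F: "\<And>x. x \<in> S \<Longrightarrow> F x \<in> carrier_mat n n" "\<And>x. x \<in> S \<Longrightarrow> adj (F x) = F x"
    and cont: "\<And>i j. i < n \<Longrightarrow> j < n \<Longrightarrow> continuous_on S (\<lambda>x. F x $$ (i,j))"
  shows "continuous_on S (\<lambda>x. trace_norm (F x))"
  unfolding continuous_on_def
proof
  fix x assume x: "x \<in> S"
  let ?g = "\<lambda>y. real n * (\<Sum>i<n. \<Sum>j<n. cmod (F y $$ (i,j) - F x $$ (i,j)))"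
  have "\<bar>trace_norm (F y) - trace_norm (F x)\<bar> \<le> ?g y" if "y \<in> S" for y
    using trace_norm_diff_le[OF F(1,2)[OF x] F(1,2)[OF that]] trace_norm_diff_le[OF F(1,2)[OF that] F(1,2)[OF x]]
    by (simp add: norm_minus_commute abs_le_iff)
  hence ev: "eventually (\<lambda>y. norm (trace_norm (F y) - trace_norm (F x)) \<le> ?g y) (at x within S)"
    by (auto simp: eventually_at_filter)
  have "((\<lambda>y. F y $$ (i,j)) \<longlongrightarrow> F x $$ (i,j)) (at x within S)" if "i < n" "j < n" for i j
    using cont[OF that] x by (auto simp: continuous_on_def)
  hence "(?g \<longlongrightarrow> real n * (\<Sum>i<n. \<Sum>j<n. cmod (F x $$ (i,j) - F x $$ (i,j)))) (at x within S)"
    by (intro tendsto_intros) auto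
  hence "(?g \<longlongrightarrow> 0) (at x within S)" by simp
  from Lim_null_comparison[OF ev this]
  show "((\<lambda>x. trace_norm (F x)) \<longlongrightarrow> trace_norm (F x)) (at x within S)"
    by (rule LIM_zero_cancel)
qed

text \<open>Parametrizes qubit vectors by pairs of complex numbers, so that compactness and
  continuity are argued in the product topology.\<close>

definition qubit :: "complex \<times> complex \<Rightarrow> complex vec" where
  "qubit p = vec 2 (\<lambda>i. if i = 0 then fst p else snd p)"

lemma qubit_carrier [simp, intro]: "qubit p \<in> carrier_vec 2"
  by (simp add: qubit_def)

lemma dim_qubit [simp]: "dim_vec (qubit p) = 2"
  by (simp add: qubit_def)

lemma qubit_surj: "a \<in> carrier_vec 2 \<Longrightarrow> a = qubit (a $ 0, a $ 1)"
  by (intro eq_vecI) (auto simp: qubit_def less_2_cases_iff)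

lemma inner2_qubit: "inner2 (qubit p) (qubit q) = cnj (fst p) * fst q + cnj (snd p) * snd q"
proof -
  have "{..<2} = {0, Suc 0}" by auto
  thus ?thesis by (simp add: inner2_def qubit_def)
qed

lemma continuous_on_qubit_entry [continuous_intros]:
  "i < 2 \<Longrightarrow> continuous_on S f \<Longrightarrow> continuous_on S (\<lambda>x. qubit (f x) $ i)"
  by (cases "i = 0") (auto simp: qubit_def intro!: continuous_intros)

text \<open>The orthonormality equations are continuous, so the set is closed; normalization puts
  every coordinate into the unit disc, so it lies in a compact product of discs.\<close>

lemma compact_qubit_onbs: "compact {p. onb2 (qubit (fst p)) (qubit (snd p))}" (is "compact ?S")
proof -
  have eq: "?S = {p. inner2 (qubit (fst p)) (qubit (fst p)) = 1 \<and> inner2 (qubit (snd p)) (qubit (snd p)) = 1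
      \<and> inner2 (qubit (fst p)) (qubit (snd p)) = 0}"
    by (auto simp: onb2_def)
  have "closed ?S"
    unfolding eq inner2_qubit by (intro closed_Collect_conj closed_Collect_eq continuous_intros)
  moreover have "cmod (fst q) \<le> 1 \<and> cmod (snd q) \<le> 1" if "inner2 (qubit q) (qubit q) = 1" for q
  proof -
    have "complex_of_real ((cmod (fst q))\<^sup>2 + (cmod (snd q))\<^sup>2) = complex_of_real 1"
      using that unfolding inner2_qubit by (simp add: complex_norm_square mult.commute flip: of_real_power)
    hence "(cmod (fst q))\<^sup>2 + (cmod (snd q))\<^sup>2 = 1" unfolding of_real_eq_iff .
    hence "(cmod (fst q))\<^sup>2 \<le> 1" "(cmod (snd q))\<^sup>2 \<le> 1"
      using zero_le_power2[of "cmod (fst q)"] zero_le_power2[of "cmod (snd q)"] by linarith+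
    thus ?thesis by (simp add: abs_square_le_1)
  qed
  hence "?S \<subseteq> (cball 0 1 \<times> cball 0 1) \<times> (cball 0 1 \<times> cball 0 1)"
    unfolding eq by (force simp: mem_Times_iff)
  ultimately show ?thesis
    using compact_Int_closed[of "(cball 0 1 \<times> cball 0 1) \<times> (cball 0 1 \<times> cball 0 (1::real))" ?S]
    by (simp add: compact_Times Int_absorb1)
qed

text \<open>Each entry is a finite sum of products of fixed entries with coordinates of the vector
  and their conjugates.\<close>

lemma continuous_on_sandwich_entry:
  fixes f :: "'a::topological_space \<Rightarrow> complex \<times> complex"
  assumes X: "X \<in> carrier_mat (2*d) (2*d)" and ij: "i < 2*d" "j < 2*d" and f: "continuous_on S f"
  shows "continuous_on S (\<lambda>x. (kron (ketbra (qubit (f x))) (1\<^sub>m d) * X * kron (ketbra (qubit (f x))) (1\<^sub>m d)) $$ (i,j))"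
proof -
  have K: "kron (ketbra (qubit q)) (1\<^sub>m d) \<in> carrier_mat (2*d) (2*d)" for q by auto
  have cK: "continuous_on S (\<lambda>x. kron (ketbra (qubit (f x))) (1\<^sub>m d) $$ (k,l))" if "k < 2*d" "l < 2*d" for k l
  proof -
    have "kron (ketbra (qubit q)) (1\<^sub>m d) $$ (k,l)
        = qubit q $ (k div d) * cnj (qubit q $ (l div d)) * 1\<^sub>m d $$ (k mod d, l mod d)" for q
      using div_mod_less[OF that(1)] div_mod_less[OF that(2)] that
      by (subst kron_index[of _ 2 2 _ d d]) (auto simp: ketbra_def)
    thus ?thesis using div_mod_less[OF that(1)] div_mod_less[OF that(2)] f
      by (auto intro!: continuous_intros)
  qed
  have "(kron (ketbra (qubit q)) (1\<^sub>m d) * X * kron (ketbra (qubit q)) (1\<^sub>m d)) $$ (i,j)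
      = (\<Sum>l<2*d. (\<Sum>k<2*d. kron (ketbra (qubit q)) (1\<^sub>m d) $$ (i,k) * X $$ (k,l))
          * kron (ketbra (qubit q)) (1\<^sub>m d) $$ (l,j))" for q
    using mult_mat_entry[OF mult_carrier_mat[OF K X] K ij] mult_mat_entry[OF K X ij(1)]
    by simp
  thus ?thesis by (auto intro!: continuous_intros cK ij)
qed

lemma dephase_distance_attains_min:
  assumes \<rho>: "\<rho> \<in> carrier_mat (2*d) (2*d)" "adj \<rho> = \<rho>"
  obtains a0 a1 where "onb2 a0 a1"
    "\<And>b0 b1. onb2 b0 b1 \<Longrightarrow> trace_norm (\<rho> - dephase d a0 a1 \<rho>) \<le> trace_norm (\<rho> - dephase d b0 b1 \<rho>)"
proof -
  let ?S = "{p. onb2 (qubit (fst p)) (qubit (snd p))}"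
  let ?F = "\<lambda>p. \<rho> - dephase d (qubit (fst p)) (qubit (snd p)) \<rho>"
  have "continuous_on ?S (\<lambda>p. trace_norm (?F p))"
  proof (rule continuous_on_trace_norm)
    fix p assume "p \<in> ?S"
    then interpret qubit_onb "qubit (fst p)" "qubit (snd p)" d by unfold_locales simp
    show "?F p \<in> carrier_mat (2*d) (2*d)" using \<rho> by (intro minus_carrier_mat dephase_carrier)
    show "adj (?F p) = ?F p" using \<rho> adj_dephase[OF \<rho>] by (simp add: adj_minus[of _ "2*d" "2*d"])
  next
    fix i j assume ij: "i < 2*d" "j < 2*d"
    let ?G = "\<lambda>q. kron (ketbra (qubit q)) (1\<^sub>m d) * \<rho> * kron (ketbra (qubit q)) (1\<^sub>m d)"
    have "?F p $$ (i,j) = \<rho> $$ (i,j) - (?G (fst p) $$ (i,j) + ?G (snd p) $$ (i,j))" for p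
    proof -
      have "?G q \<in> carrier_mat (2*d) (2*d)" for q
        using \<rho> kron_carrier[OF ketbra_carrier[OF qubit_carrier[of q]] one_carrier_mat[of d]]
        by (intro mult_carrier_mat[of _ "2*d" "2*d"])
      moreover have "(\<rho> - (A + B)) $$ (i,j) = \<rho> $$ (i,j) - (A $$ (i,j) + B $$ (i,j))"
        if "A \<in> carrier_mat (2*d) (2*d)" "B \<in> carrier_mat (2*d) (2*d)" for A B
        using that ij by simp
      ultimately show ?thesis unfolding dephase_def by blast
    qed
    moreover have "continuous_on ?S (\<lambda>p. \<rho> $$ (i,j) - (?G (fst p) $$ (i,j) + ?G (snd p) $$ (i,j)))"
      by (intro continuous_intros continuous_on_sandwich_entry[OF \<rho>(1) ij])
    ultimately show "continuous_on ?S (\<lambda>p. ?F p $$ (i,j))" by simp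
  qed
  \<comment> \<open>The standard basis shows that the compact set is nonempty, as attainment of the
    infimum requires.\<close>
  moreover have "((1,0),(0,1)) \<in> ?S" by (simp add: onb2_def inner2_qubit)
  ultimately obtain p where p: "p \<in> ?S" and min: "\<And>q. q \<in> ?S \<Longrightarrow> trace_norm (?F p) \<le> trace_norm (?F q)"
    using continuous_attains_inf[OF compact_qubit_onbs, of "\<lambda>p. trace_norm (?F p)"] by blast
  have "trace_norm (?F p) \<le> trace_norm (\<rho> - dephase d b0 b1 \<rho>)" if "onb2 b0 b1" for b0 b1
  proof -
    \<comment> \<open>Every basis arises from its coordinates, so the minimum over parameters is one
      over all bases.\<close>
    have "qubit (b0 $ 0, b0 $ 1) = b0" "qubit (b1 $ 0, b1 $ 1) = b1"
      using that unfolding onb2_def by (blast intro: qubit_surj[symmetric])+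
    thus ?thesis using min[of "((b0 $ 0, b0 $ 1), (b1 $ 0, b1 $ 1))"] that by simp
  qed
  thus ?thesis using that p by blast
qed

theorem theorem8:
  fixes d :: nat and \<rho> :: "complex mat"
  assumes "density_state (2 * d) \<rho>"
  shows "\<exists>m. (\<exists>a0 a1. onb2 a0 a1 \<and> trace_norm (\<rho> - dephase d a0 a1 \<rho>) = m)
           \<and> (\<forall>a0 a1. onb2 a0 a1 \<longrightarrow> m \<le> trace_norm (\<rho> - dephase d a0 a1 \<rho>))
           \<and> (\<exists>\<sigma>. cq_state d \<sigma> \<and> trace_norm (\<rho> - \<sigma>) = m)
           \<and> (\<forall>\<sigma>. cq_state d \<sigma> \<longrightarrow> m \<le> trace_norm (\<rho> - \<sigma>))"
proof -
  have \<rho>: "\<rho> \<in> carrier_mat (2*d) (2*d)" "adj \<rho> = \<rho>"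
    using assms by (auto simp: density_state_def psd_def)
  obtain a0 a1 where onb: "onb2 a0 a1"
    and min: "\<And>b0 b1. onb2 b0 b1 \<Longrightarrow> trace_norm (\<rho> - dephase d a0 a1 \<rho>) \<le> trace_norm (\<rho> - dephase d b0 b1 \<rho>)"
    using dephase_distance_attains_min[OF \<rho>] by blast
  interpret qubit_onb a0 a1 d by unfold_locales (rule onb)
  have "trace_norm (\<rho> - dephase d a0 a1 \<rho>) \<le> trace_norm (\<rho> - \<sigma>)" if \<sigma>: "cq_state d \<sigma>" for \<sigma>
  proof -
    obtain b0 b1 s0 s1 where cq: "onb2 b0 b1" "psd d s0" "psd d s1"
      "\<sigma> = kron (ketbra b0) s0 + kron (ketbra b1) s1"
      using \<sigma> unfolding cq_state_def by blast
    \<comment> \<open>The basis of \<open>\<sigma>\<close> need not be the optimal one: optimality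
      first passes to the basis of \<open>\<sigma>\<close>, and dephasing there is no farther from
      \<open>\<rho>\<close> than \<open>\<sigma>\<close> is.\<close>
    show ?thesis using min[OF cq(1)] trace_norm_minus_dephase_le_cq[OF \<rho> cq] by linarith
  qed
  \<comment> \<open>The common minimum is the distance at the optimal basis; the state dephased
    there attains it among classical-quantum states.\<close>
  thus ?thesis using onb min cq_state_dephase[OF assms] by blast
qed

end
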